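(* Let $W=(w_{ij})\in\mathbb{R}^{N\times N}$ be a symmetric matrix with nonnegative entries, let $\Gamma_1,\dots,\Gamma_k$ be a partition of $\{1,\dots,N\}$ into nonempty sets such that every within-cluster degree $\sum_{j\in\Gamma_a}w_{ij}$ ($i\in\Gamma_a$, $1\le a\le k$) is positive, and let $D$, $L_{\mathrm{sym}}$, $L_{\mathrm{rw},\mathrm{iso}}$, $P_{\mathrm{iso}}$, $P_\delta$, $X_{\mathrm{ncut}}$ be the associated matrices defined in the context. If $$\frac{\|P_\delta\|_\infty}{1-\|P_\delta\|_\infty}<\frac{\lambda_{k+1}(L_{\mathrm{rw},\mathrm{iso}})}{4},$$ then $X_{\mathrm{ncut}}$ is the unique global minimizer of the semidefinite program $$\min_{Z\in\mathbb{R}^{N\times N},\ Z=Z^\top}\ \langle L_{\mathrm{sym}},Z\rangle\quad\text{subject to}\quad Z\succeq 0,\quad Z\ge 0,\quad \operatorname{Tr}(Z)=k,\quad ZD^{1/2}1_N=D^{1/2}1_N .$$ Moreover, $\lambda_{k+1}(L_{\mathrm{rw},\mathrm{iso}})=\min_{1\le a\le k}\lambda_2\big(L_{\mathrm{rw},\mathrm{iso}}^{(a,a)}\big)=\min_{1\le a\le k}\lambda_2\big(I_{n_a}-P_{\mathrm{iso}}^{(a,a)}\big)$.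
   Context: Notation: $\lambda_l(M)$ is the $l$-th smallest eigenvalue of $M$, counted with multiplicity (all matrices to which it is applied have real spectrum); $\|M\|_\infty=\max_i\sum_j|M_{ij}|$; $\langle M,Z\rangle=\operatorname{Tr}(M^\top Z)$; $Z\succeq0$ means positive semidefinite; $Z\ge0$ means entrywise nonnegative; $1_N$ is the all-ones vector. Given $W$ and the partition, let $n_a=|\Gamma_a|$; for $M\in\mathbb{R}^{N\times N}$, $M^{(a,b)}$ is the block with rows in $\Gamma_a$ and columns in $\Gamma_b$. Let $D=\operatorname{diag}(W1_N)$, $L=D-W$, $L_{\mathrm{sym}}=D^{-1/2}LD^{-1/2}=I_N-D^{-1/2}WD^{-1/2}$. Let $W_{\mathrm{iso}}$ be the matrix with $W_{\mathrm{iso}}^{(a,a)}=W^{(a,a)}$ and $W_{\mathrm{iso}}^{(a,b)}=0$ for $a\neq b$; $D_{\mathrm{iso}}=\operatorname{diag}(W_{\mathrm{iso}}1_N)$; $P_{\mathrm{iso}}=D_{\mathrm{iso}}^{-1}W_{\mathrm{iso}}$; $L_{\mathrm{rw},\mathrm{iso}}=I_N-P_{\mathrm{iso}}$. Let $W_\delta=W-W_{\mathrm{iso}}$ and $P_\delta=D^{-1}W_\delta$. Finally $$X_{\mathrm{ncut}}=\sum_{a=1}^k\frac{1}{1_{\Gamma_a}^\top D1_{\Gamma_a}}D^{1/2}1_{\Gamma_a}1_{\Gamma_a}^\top D^{1/2},$$ where $1_{\Gamma_a}\in\mathbb{R}^N$ is the indicator vector of $\Gamma_a$. Conventions: $N>k$,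 so that $\lambda_{k+1}$ exists; $\lambda_2$ of a $1\times1$ matrix is taken to be $+\infty$. *)

theory Defs
  imports
    "HOL-Library.Extended_Real"
    "HOL-Library.Disjoint_Sets"
    "Jordan_Normal_Form.Char_Poly"
    "Jordan_Normal_Form.DL_Submatrix"
begin

text \<open>Matrices are those of \<^theory>\<open>Jordan_Normal_Form.Matrix\<close>, so vertices are numbered
  from 0 to N - 1 and clusters from 0 to k - 1. On these matrices the order relation
  is the entrywise one (not the Loewner order).\<close>

text \<open>The l-th smallest eigenvalue for l at least 1, counted with algebraic multiplicity, of a
  matrix with real spectrum; it is infinite if the matrix has fewer than l rows. For a matrix
  with non-real eigenvalues the list below is too short and the value is meaningless.\<close>

definition lambda :: "nat \<Rightarrow> real mat \<Rightarrow> ereal" where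
  "lambda l M =
     (if l \<le> dim_row M
      then ereal (sorted_list_of_multiset (proots (char_poly M)) ! (l - 1))
      else \<infinity>)"

definition norm_inf :: "real mat \<Rightarrow> real" where
  "norm_inf M = Max ((\<lambda>i. \<Sum>j<dim_col M. \<bar>M $$ (i, j)\<bar>) ` {..<dim_row M})"

definition tr :: "real mat \<Rightarrow> real" where
  "tr M = (\<Sum>i<dim_row M. M $$ (i, i))"

definition inner_mat :: "real mat \<Rightarrow> real mat \<Rightarrow> real" where
  "inner_mat M Z = tr (transpose_mat M * Z)"

definition psd :: "nat \<Rightarrow> real mat \<Rightarrow> bool" where
  "psd n Z \<longleftrightarrow> Z \<in> carrier_mat n n \<and> transpose_mat Z = Z \<and>
     (\<forall>v \<in> carrier_vec n. 0 \<le> v \<bullet> (Z *\<^sub>v v))"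

definition ones :: "nat \<Rightarrow> real vec" where
  "ones n = vec n (\<lambda>_. 1)"

definition ind_vec :: "nat \<Rightarrow> nat set \<Rightarrow> real vec" where
  "ind_vec n S = vec n (\<lambda>i. if i \<in> S then 1 else 0)"

definition col_mat :: "real vec \<Rightarrow> real mat" where
  "col_mat v = mat_of_cols (dim_vec v) [v]"

definition block :: "(nat \<Rightarrow> nat set) \<Rightarrow> nat \<Rightarrow> nat \<Rightarrow> real mat \<Rightarrow> real mat" where
  "block \<Gamma> a b M = submatrix M (\<Gamma> a) (\<Gamma> b)"

definition indexed_partition :: "nat \<Rightarrow> nat \<Rightarrow> (nat \<Rightarrow> nat set) \<Rightarrow> bool" where
  "indexed_partition n k \<Gamma> \<longleftrightarrow>
     (\<Union>a<k. \<Gamma> a) = {..<n} \<and> disjoint_family_on \<Gamma> {..<k} \<and> (\<forall>a<k. \<Gamma> a \<noteq> {})"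

definition deg_mat :: "real mat \<Rightarrow> real mat" where
  "deg_mat W = mat_diag (dim_row W) (\<lambda>i. (W *\<^sub>v ones (dim_row W)) $ i)"

text \<open>Functions of a diagonal matrix act on its diagonal entries; they are applied to
  degree matrices with positive diagonal only.\<close>

definition diag_inv :: "real mat \<Rightarrow> real mat" where
  "diag_inv D = mat_diag (dim_row D) (\<lambda>i. 1 / D $$ (i, i))"

definition diag_sqrt :: "real mat \<Rightarrow> real mat" where
  "diag_sqrt D = mat_diag (dim_row D) (\<lambda>i. sqrt (D $$ (i, i)))"

definition L_sym :: "real mat \<Rightarrow> real mat" where
  "L_sym W = diag_inv (diag_sqrt (deg_mat W)) * (deg_mat W - W)
               * diag_inv (diag_sqrt (deg_mat W))"

definition W_iso :: "nat \<Rightarrow> (nat \<Rightarrow> nat set) \<Rightarrow> real mat \<Rightarrow> real mat" where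
  "W_iso k \<Gamma> W = mat (dim_row W) (dim_col W)
     (\<lambda>(i, j). if \<exists>a<k. i \<in> \<Gamma> a \<and> j \<in> \<Gamma> a then W $$ (i, j) else 0)"

definition P_iso :: "nat \<Rightarrow> (nat \<Rightarrow> nat set) \<Rightarrow> real mat \<Rightarrow> real mat" where
  "P_iso k \<Gamma> W = diag_inv (deg_mat (W_iso k \<Gamma> W)) * W_iso k \<Gamma> W"

definition L_rw_iso :: "nat \<Rightarrow> (nat \<Rightarrow> nat set) \<Rightarrow> real mat \<Rightarrow> real mat" where
  "L_rw_iso k \<Gamma> W = 1\<^sub>m (dim_row W) - P_iso k \<Gamma> W"

definition P_delta :: "nat \<Rightarrow> (nat \<Rightarrow> nat set) \<Rightarrow> real mat \<Rightarrow> real mat" where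
  "P_delta k \<Gamma> W = diag_inv (deg_mat W) * (W - W_iso k \<Gamma> W)"

definition X_ncut :: "nat \<Rightarrow> (nat \<Rightarrow> nat set) \<Rightarrow> real mat \<Rightarrow> real mat" where
  "X_ncut k \<Gamma> W =
     (let n = dim_row W; D = deg_mat W; e = (\<lambda>a. ind_vec n (\<Gamma> a)) in
      mat n n (\<lambda>(i, j). \<Sum>a<k.
        ((1 / (e a \<bullet> (D *\<^sub>v e a))) \<cdot>\<^sub>m
           (diag_sqrt D * col_mat (e a) * transpose_mat (col_mat (e a)) * diag_sqrt D)) $$ (i, j)))"

definition feasible :: "nat \<Rightarrow> real mat \<Rightarrow> real mat \<Rightarrow> bool" where
  "feasible k W Z \<longleftrightarrow>
     (let n = dim_row W; u = diag_sqrt (deg_mat W) *\<^sub>v ones n in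
      Z \<in> carrier_mat n n \<and> transpose_mat Z = Z \<and>
      psd n Z \<and> 0\<^sub>m n n \<le> Z \<and> tr Z = real k \<and> Z *\<^sub>v u = u)"

end

theory Submission
  imports Defs
begin

text \<open>
  Write \<open>d\<close> for the degrees, \<open>\<epsilon>\<close> for the norm of \<open>P\<^sub>\<delta>\<close>, and \<open>Z\<^sub>i\<^sub>j = \<surd>d\<^sub>i \<surd>d\<^sub>j Y\<^sub>i\<^sub>j\<close>
  for a feasible point. The objective is then the Laplacian of \<open>W\<close> paired with \<open>Y\<close>, and it
  splits into a part from edges inside the clusters and a part from edges between them. Let
  \<open>t = k - \<langle>X, Z\<rangle> \<ge> 0\<close> with \<open>X\<close> the normalised cut point; this is the suitably weighted mass of \<open>Y\<close>
  outside the diagonal blocks, and also the total within-cluster variance of the Gram vectors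
  of \<open>Y\<close>. By the Poincare inequality on each cluster, the inside part is at least
  \<open>(1 - \<epsilon>) \<mu> t\<close>, where \<open>\<mu>\<close> is the spectral gap and the factor \<open>1 - \<epsilon>\<close> accounts for the passage
  from inside degrees to \<open>d\<close>. The between part is a positive semidefinite form \<open>B\<close>. Replacing its
  argument \<open>x\<close> by the cluster means \<open>m\<close> via \<open>B(x, x) \<ge> 2 B(x, m) - B(m, m)\<close> and using \<open>Y \<ge> 0\<close>
  and the row sum constraint, it is at least its value at \<open>X\<close> minus \<open>4 \<epsilon> t\<close>. Hence the
  objective exceeds that of \<open>X\<close> by at least \<open>((1 - \<epsilon>) \<mu> - 4 \<epsilon>) t\<close>, and \<open>t = 0\<close> forces
  \<open>Z = X\<close>. For the eigenvalues, orthonormal eigenbases of the symmetrised diagonal blocks,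
  each starting with the known null vector, glue to an eigenbasis of the whole matrix.
\<close>

section \<open>Spectral theorem for real symmetric matrices\<close>

text \<open>Over the complex numbers the fundamental theorem of algebra supplies an eigenvalue.
  Symmetry forces it to be real, and then the real or the imaginary part of its eigenvector,
  whichever is nonzero, is a real eigenvector. The index set is any finite set, so that the result
  applies to single clusters without renumbering.\<close>

lemma symmetric_has_eigenvector:
  fixes S :: "'a \<Rightarrow> 'a \<Rightarrow> real"
  assumes fin: "finite I" and ne: "I \<noteq> {}"
    and sym: "\<And>i j. i \<in> I \<Longrightarrow> j \<in> I \<Longrightarrow> S i j = S j i"
  obtains v c where "(\<Sum>i\<in>I. (v i)\<^sup>2) = 1" "\<And>i. i \<in> I \<Longrightarrow> (\<Sum>j\<in>I. S i j * v j) = c * v i"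
proof -
  define n where "n = card I"
  obtain f where f: "bij_betw f {0..<n} I"
    using ex_bij_betw_nat_finite[OF fin] unfolding n_def by blast
  define A where "A = Matrix.mat n n (\<lambda>(i, j). complex_of_real (S (f i) (f j)))"
  have A: "A \<in> carrier_mat n n" by (simp add: A_def)
  have "n > 0" using fin ne by (simp add: n_def card_gt_0_iff)
  then have "degree (char_poly A) \<noteq> 0" using degree_monic_char_poly[OF A] by simp
  then have "\<not> constant (poly (char_poly A))" by (simp add: constant_degree)
  then obtain m where "poly (char_poly A) m = 0" using fundamental_theorem_of_algebra by blast
  then have "eigenvalue A m" by (simp add: eigenvalue_root_char_poly[OF A])
  then obtain w where w: "w \<in> carrier_vec n" "w \<noteq> 0\<^sub>v n" "A *\<^sub>v w = m \<cdot>\<^sub>v w"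
    using A unfolding eigenvalue_def eigenvector_def by auto
  define z where "z i = w $ (the_inv_into {0..<n} f i)" for i
  have zf: "z (f r) = w $ r" if "r < n" for r
    using f that by (simp add: z_def bij_betw_def the_inv_into_f_f)
  have eig: "(\<Sum>j\<in>I. complex_of_real (S i j) * z j) = m * z i" if "i \<in> I" for i
  proof -
    obtain r where r: "r < n" "i = f r" using f \<open>i \<in> I\<close> by (auto simp: bij_betw_def)
    have "(\<Sum>j\<in>I. complex_of_real (S i j) * z j) = (\<Sum>s\<in>{0..<n}. complex_of_real (S i (f s)) * z (f s))"
      by (rule sum.reindex_bij_betw[OF f, symmetric])
    also have "\<dots> = (A *\<^sub>v w) $ r"
      using r w(1) by (simp add: A_def scalar_prod_def zf)
    also have "\<dots> = m * z i" using r w zf by simp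
    finally show ?thesis .
  qed
  have zne: "\<exists>i\<in>I. z i \<noteq> 0"
  proof (rule ccontr)
    assume *: "\<not> ?thesis"
    have "w $ r = 0" if "r < n" for r
      using * zf[OF that] f that by (metis atLeastLessThan_iff bij_betwE le0)
    then show False using w by (auto intro: eq_vecI)
  qed
  define x where "x i = Re (z i)" for i
  define y where "y i = Im (z i)" for i
  define a where "a = Re m"
  define b where "b = Im m"
  have ex: "(\<Sum>j\<in>I. S i j * x j) = a * x i - b * y i" if "i \<in> I" for i
    using arg_cong[OF eig[OF that], of Re] by (simp add: x_def y_def a_def b_def)
  have ey: "(\<Sum>j\<in>I. S i j * y j) = b * x i + a * y i" if "i \<in> I" for i
    using arg_cong[OF eig[OF that], of Im] by (simp add: x_def y_def a_def b_def algebra_simps)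
  have pos: "(\<Sum>i\<in>I. (x i)\<^sup>2 + (y i)\<^sup>2) > 0"
  proof -
    obtain i where "i \<in> I" "z i \<noteq> 0" using zne by blast
    then have "(x i)\<^sup>2 + (y i)\<^sup>2 > 0"
      by (simp add: x_def y_def complex_eq_iff sum_power2_gt_zero_iff)
    then show ?thesis using fin \<open>i \<in> I\<close> by (intro sum_pos2) auto
  qed
  \<comment> \<open>By symmetry \<open>y\<close> paired with \<open>S x\<close> equals
    \<open>x\<close> paired with \<open>S y\<close>; comparing the two eigenvector relations leaves
    \<open>b\<close> times the squared norm equal to zero.\<close>
  have "(\<Sum>i\<in>I. y i * (a * x i - b * y i)) = (\<Sum>i\<in>I. \<Sum>j\<in>I. y i * (S i j * x j))"
    by (intro sum.cong refl) (simp add: ex[symmetric] sum_distrib_left)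
  also have "\<dots> = (\<Sum>j\<in>I. \<Sum>i\<in>I. y i * (S i j * x j))" by (rule sum.swap)
  also have "\<dots> = (\<Sum>j\<in>I. \<Sum>i\<in>I. x j * (S j i * y i))"
    by (intro sum.cong refl) (simp add: sym)
  also have "\<dots> = (\<Sum>j\<in>I. x j * (b * x j + a * y j))"
    by (intro sum.cong refl) (simp add: ey[symmetric] sum_distrib_left)
  finally have "b * (\<Sum>i\<in>I. (x i)\<^sup>2 + (y i)\<^sup>2) = 0"
    by (simp add: algebra_simps sum.distrib sum_subtractf sum_distrib_left power2_eq_square)
  then have b: "b = 0" using pos by simp
  have "\<exists>v. (\<Sum>i\<in>I. (v i)\<^sup>2) > 0 \<and> (\<forall>i\<in>I. (\<Sum>j\<in>I. S i j * v j) = a * v i)"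
  proof (cases "(\<Sum>i\<in>I. (x i)\<^sup>2) > 0")
    case True
    then show ?thesis using ex b by (intro exI[of _ x]) simp
  next
    case False
    then have "(\<Sum>i\<in>I. (y i)\<^sup>2) > 0" using pos by (simp add: sum.distrib)
    then show ?thesis using ey b by (intro exI[of _ y]) simp
  qed
  then obtain v where v: "(\<Sum>i\<in>I. (v i)\<^sup>2) > 0" "\<forall>i\<in>I. (\<Sum>j\<in>I. S i j * v j) = a * v i" by blast
  define s where "s = sqrt (\<Sum>i\<in>I. (v i)\<^sup>2)"
  have s: "s > 0" "s\<^sup>2 = (\<Sum>i\<in>I. (v i)\<^sup>2)" using v by (simp_all add: s_def)
  show ?thesis
  proof (rule that[of "\<lambda>i. v i / s" a])
    show "(\<Sum>i\<in>I. (v i / s)\<^sup>2) = 1"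
      using s v by (simp add: power_divide flip: sum_divide_distrib)
    show "(\<Sum>j\<in>I. S i j * (v j / s)) = a * (v i / s)" if "i \<in> I" for i
      using v(2) that by (simp flip: sum_divide_distrib)
  qed
qed

text \<open>The basis vectors are the columns of \<open>q\<close>. The row relations serve for
  Parseval, the column relations for isolating a single eigenvalue.\<close>

definition orth_on :: "'a set \<Rightarrow> ('a \<Rightarrow> 'a \<Rightarrow> real) \<Rightarrow> bool" where
  "orth_on I q \<longleftrightarrow> (\<forall>i\<in>I. \<forall>j\<in>I. (\<Sum>l\<in>I. q i l * q j l) = of_bool (i = j)
                                 \<and> (\<Sum>l\<in>I. q l i * q l j) = of_bool (i = j))"

lemma sum_of_bool_eq [simp]:
  fixes g :: "'a \<Rightarrow> real"
  assumes "finite I" "j \<in> I"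
  shows "(\<Sum>l\<in>I. of_bool (l = j) * g l) = g j" "(\<Sum>l\<in>I. of_bool (j = l) * g l) = g j"
    "(\<Sum>l\<in>I. g l * of_bool (l = j)) = g j" "(\<Sum>l\<in>I. g l * of_bool (j = l)) = g j"
  using assms by (simp_all add: of_bool_def if_distrib if_distribR sum.delta sum.delta' cong: if_cong)

text \<open>Matrices are plain functions here, and this regrouping takes the place of associativity
  of the matrix product.\<close>

lemma sum_prod_sums:
  fixes a b :: "'a \<Rightarrow> real" and c d :: "'a \<Rightarrow> 'b \<Rightarrow> real"
  shows "(\<Sum>l\<in>L. (\<Sum>j\<in>I. a j * c j l) * (\<Sum>m\<in>J. b m * d m l))
       = (\<Sum>j\<in>I. a j * (\<Sum>m\<in>J. b m * (\<Sum>l\<in>L. c j l * d m l)))"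
proof -
  have "(\<Sum>l\<in>L. (\<Sum>j\<in>I. a j * c j l) * (\<Sum>m\<in>J. b m * d m l))
      = (\<Sum>l\<in>L. \<Sum>j\<in>I. \<Sum>m\<in>J. a j * (b m * (c j l * d m l)))"
    by (intro sum.cong refl) (simp add: sum_product mult_ac)
  also have "\<dots> = (\<Sum>j\<in>I. \<Sum>l\<in>L. \<Sum>m\<in>J. a j * (b m * (c j l * d m l)))" by (rule sum.swap)
  also have "\<dots> = (\<Sum>j\<in>I. \<Sum>m\<in>J. \<Sum>l\<in>L. a j * (b m * (c j l * d m l)))"
    by (intro sum.cong refl sum.swap)
  finally show ?thesis by (simp add: sum_distrib_left)
qed

lemma orth_on_mult:
  assumes "finite I" "orth_on I A" "orth_on I B"
  shows "orth_on I (\<lambda>i l. \<Sum>j\<in>I. A i j * B j l)"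
  unfolding orth_on_def
proof (intro ballI conjI)
  fix i j assume ij: "i \<in> I" "j \<in> I"
  have "(\<Sum>l\<in>I. (\<Sum>r\<in>I. A i r * B r l) * (\<Sum>r\<in>I. A j r * B r l))
      = (\<Sum>r\<in>I. A i r * (\<Sum>m\<in>I. A j m * of_bool (r = m)))"
    unfolding sum_prod_sums using assms(3) by (intro sum.cong refl) (simp add: orth_on_def)
  also have "\<dots> = of_bool (i = j)"
    using assms ij by (simp add: orth_on_def)
  finally show "(\<Sum>l\<in>I. (\<Sum>r\<in>I. A i r * B r l) * (\<Sum>r\<in>I. A j r * B r l)) = of_bool (i = j)" .
  have "(\<Sum>l\<in>I. (\<Sum>r\<in>I. A l r * B r i) * (\<Sum>r\<in>I. A l r * B r j))
      = (\<Sum>l\<in>I. (\<Sum>r\<in>I. B r i * A l r) * (\<Sum>r\<in>I. B r j * A l r))"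
    by (simp add: mult.commute)
  also have "\<dots> = (\<Sum>r\<in>I. B r i * (\<Sum>m\<in>I. B m j * of_bool (r = m)))"
    unfolding sum_prod_sums using assms(2) by (intro sum.cong refl) (simp add: orth_on_def)
  also have "\<dots> = of_bool (i = j)"
    using assms ij by (simp add: orth_on_def)
  finally show "(\<Sum>l\<in>I. (\<Sum>r\<in>I. A l r * B r i) * (\<Sum>r\<in>I. A l r * B r j)) = of_bool (i = j)" .
qed

text \<open>The matrix is the Householder reflection that exchanges \<open>v\<close> and the basis vector at
  \<open>z\<close>. If the two coincide, the denominator is zero and division by zero gives the identity.\<close>

lemma orthogonal_with_first_column:
  fixes v :: "'a \<Rightarrow> real"
  assumes fin: "finite I" and z: "z \<in> I" and unit: "(\<Sum>i\<in>I. (v i)\<^sup>2) = 1"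
  obtains H where "orth_on I H" "\<And>i j. H i j = H j i" "\<And>i. i \<in> I \<Longrightarrow> H i z = v i"
proof -
  define w where "w i = v i - of_bool (i = z)" for i
  define s where "s = (\<Sum>i\<in>I. (w i)\<^sup>2)"
  define c where "c = 2 / s"
  define H where "H i j = of_bool (i = j) - c * (w i * w j)" for i j
  have sym: "H i j = H j i" for i j by (simp add: H_def mult_ac)
  \<comment> \<open>This holds for \<open>s = 0\<close> as well, since then \<open>c = 0\<close>;
    orthogonality of \<open>H\<close> thus needs no case distinction.\<close>
  have cs: "c * (c * s) = 2 * c" by (simp add: c_def)
  have row: "(\<Sum>l\<in>I. H i l * H j l) = of_bool (i = j)" if "i \<in> I" "j \<in> I" for i j
  proof -
    have "H i l * H j l = of_bool (i = l) * of_bool (j = l) - (of_bool (i = l) * (c * (w j * w l)))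
        - of_bool (j = l) * (c * (w i * w l)) + c * c * (w i * w j) * (w l)\<^sup>2" for l
      by (simp add: H_def algebra_simps power2_eq_square)
    then have "(\<Sum>l\<in>I. H i l * H j l) = (\<Sum>l\<in>I. of_bool (i = l) * of_bool (j = l))
        - (\<Sum>l\<in>I. of_bool (i = l) * (c * (w j * w l))) - (\<Sum>l\<in>I. of_bool (j = l) * (c * (w i * w l)))
        + (\<Sum>l\<in>I. c * c * (w i * w j) * (w l)\<^sup>2)"
      by (simp only: sum.distrib sum_subtractf)
    also have "(\<Sum>l\<in>I. c * c * (w i * w j) * (w l)\<^sup>2) = c * (c * s) * (w i * w j)"
      unfolding s_def sum_distrib_left[symmetric] by (simp add: mult_ac)
    finally have "(\<Sum>l\<in>I. H i l * H j l)
        = of_bool (j = i) - c * (w j * w i) - c * (w i * w j) + c * (c * s) * (w i * w j)"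
      by (simp only: sum_of_bool_eq(2)[OF fin that(1)] sum_of_bool_eq(2)[OF fin that(2)])
    then show ?thesis unfolding cs by (auto simp: mult_ac)
  qed
  \<comment> \<open>The vector \<open>v\<close> and the basis vector at \<open>z\<close> both have
    norm 1, so the squared distance between them is \<open>2 - 2 * v z\<close>.\<close>
  have ws: "s = - 2 * w z"
  proof -
    have "s = (\<Sum>i\<in>I. (v i)\<^sup>2 - of_bool (i = z) * (2 * v i - 1))"
      unfolding s_def w_def by (intro sum.cong refl) (auto simp: power2_eq_square algebra_simps)
    also have "\<dots> = - 2 * w z" using fin z unit by (simp add: sum_subtractf w_def)
    finally show ?thesis .
  qed
  have "H i z = v i" if "i \<in> I" for i
  proof (cases "s = 0")
    case True
    then have "w i = 0" using that fin by (simp add: s_def sum_nonneg_eq_0_iff)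
    then show ?thesis by (simp add: H_def w_def)
  next
    case False
    then have "c * w z = - 1" using ws by (simp add: c_def field_simps)
    moreover have "c * (w i * w z) = w i * (c * w z)" by simp
    ultimately have "H i z = of_bool (i = z) + w i" by (simp add: H_def)
    then show ?thesis by (simp add: w_def)
  qed
  with row sym show ?thesis by (intro that[of H]) (auto simp: orth_on_def sym)
qed

text \<open>Deflation: conjugation by a reflection whose column at \<open>z\<close> is
  \<open>v\<close> splits off the eigenvalue \<open>c\<close>, and the rest is diagonalised by
  induction on the cardinality. The eigenvector at \<open>z\<close> is prescribed because the
  decomposition of each cluster has to contain a known null vector at a known index.\<close>

theorem spectral_theorem_with_eigenvector:
  fixes S :: "'a \<Rightarrow> 'a \<Rightarrow> real"
  assumes "finite I" "z \<in> I"
    and "\<And>i j. i \<in> I \<Longrightarrow> j \<in> I \<Longrightarrow> S i j = S j i"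
    and "(\<Sum>i\<in>I. (v i)\<^sup>2) = 1" "\<And>i. i \<in> I \<Longrightarrow> (\<Sum>j\<in>I. S i j * v j) = c * v i"
  shows "\<exists>q e. orth_on I q \<and> e z = c \<and> (\<forall>i\<in>I. q i z = v i)
    \<and> (\<forall>i\<in>I. \<forall>j\<in>I. S i j = (\<Sum>l\<in>I. e l * (q i l * q j l)))"
  using assms
proof (induction "card I" arbitrary: I z S v c)
  case 0
  then show ?case by auto
next
  case (Suc n)
  note fin = Suc.prems(1) and z = Suc.prems(2) and sym = Suc.prems(3) and eig = Suc.prems(5)
  obtain H where H: "orth_on I H" "\<And>i j. H i j = H j i" "\<And>i. i \<in> I \<Longrightarrow> H i z = v i"
    using orthogonal_with_first_column[OF fin z Suc.prems(4)] by blast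
  define J where "J = I - {z}"
  have I: "I = insert z J" "z \<notin> J" "finite J" and cJ: "card J = n"
    using z fin Suc.hyps(2) by (auto simp: J_def)
  \<comment> \<open>As \<open>H\<close> is symmetric, this is the conjugate
    \<open>H S H\<close>.\<close>
  define K where "K i j = (\<Sum>p\<in>I. H i p * (\<Sum>r\<in>I. H r j * S p r))" for i j
  have Ksym: "K i j = K j i" for i j
  proof -
    have "K i j = (\<Sum>p\<in>I. \<Sum>r\<in>I. H i p * (H r j * S p r))" by (simp add: K_def sum_distrib_left)
    also have "\<dots> = (\<Sum>r\<in>I. \<Sum>p\<in>I. H j r * (H p i * S r p))"
      by (subst sum.swap, intro sum.cong refl) (simp add: sym H(2) mult_ac)
    finally show ?thesis by (simp add: K_def sum_distrib_left)
  qed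
  \<comment> \<open>\<open>S\<close> maps \<open>v\<close> to \<open>c\<close> times
    \<open>v\<close>, and \<open>v\<close> is the column of \<open>H\<close> at \<open>z\<close>;
    orthonormality of \<open>H\<close> does the rest.\<close>
  have Kz: "K i z = c * of_bool (i = z)" if "i \<in> I" for i
  proof -
    have "K i z = (\<Sum>p\<in>I. H i p * (\<Sum>r\<in>I. S p r * v r))"
      unfolding K_def by (intro sum.cong refl) (simp add: H(3) mult.commute)
    also have "\<dots> = (\<Sum>p\<in>I. c * (H i p * H z p))"
      by (intro sum.cong refl) (simp add: eig H(2)[of z] H(3))
    also have "\<dots> = c * (\<Sum>p\<in>I. H i p * H z p)" by (simp add: sum_distrib_left)
    finally show ?thesis using H(1) that z by (simp add: orth_on_def)
  qed
  have "\<exists>q e. orth_on J q \<and> (\<forall>i\<in>J. \<forall>j\<in>J. K i j = (\<Sum>l\<in>J. e l * (q i l * q j l)))"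
  proof (cases "J = {}")
    case True
    then show ?thesis by (simp add: orth_on_def)
  next
    case False
    then obtain y where y: "y \<in> J" by blast
    \<comment> \<open>The induction hypothesis asks for some prescribed eigenvector, so an arbitrary
      one is placed at an arbitrary index of \<open>J\<close>.\<close>
    obtain v' c' where v': "(\<Sum>i\<in>J. (v' i)\<^sup>2) = 1" "\<And>i. i \<in> J \<Longrightarrow> (\<Sum>j\<in>J. K i j * v' j) = c' * v' i"
      using symmetric_has_eigenvector[OF I(3) False, of K] Ksym by blast
    from Suc.hyps(1)[OF cJ[symmetric] I(3) y, of K v' c'] Ksym v' show ?thesis by blast
  qed
  then obtain q' e' where q': "orth_on J q'"
    and K: "\<And>i j. i \<in> J \<Longrightarrow> j \<in> J \<Longrightarrow> K i j = (\<Sum>l\<in>J. e' l * (q' i l * q' j l))" by blast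
  \<comment> \<open>The block sum of the entry 1 at \<open>z\<close> and \<open>q'\<close> on
    \<open>J\<close>; the eigenbasis of \<open>S\<close> will be \<open>H\<close> times this
    matrix.\<close>
  define q2 where "q2 j l = (if j = z \<or> l = z then of_bool (j = l) else q' j l)" for j l
  define e where "e l = (if l = z then c else e' l)" for l
  have q2z: "q2 i z = of_bool (i = z)" "q2 z i = of_bool (i = z)" for i by (auto simp: q2_def)
  have q2J: "q2 i l = q' i l" "e l = e' l" if "i \<in> J" "l \<in> J" for i l
    using that I(2) by (auto simp: q2_def e_def)
  have orth2: "orth_on I q2"
    unfolding orth_on_def
  proof (intro ballI conjI)
    fix i j assume ij: "i \<in> I" "j \<in> I"
    have neJ: "l \<noteq> z" if "l \<in> J" for l using I(2) that by auto
    have "(\<Sum>l\<in>J. q2 i l * q2 j l) = of_bool (i = j \<and> i \<noteq> z)"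
    proof (cases "i \<in> J \<and> j \<in> J")
      case True
      then have "(\<Sum>l\<in>J. q2 i l * q2 j l) = (\<Sum>l\<in>J. q' i l * q' j l)"
        by (intro sum.cong refl) (simp add: q2J)
      then show ?thesis using q' True neJ by (simp add: orth_on_def)
    qed (use ij I neJ in \<open>auto simp: q2z\<close>)
    then show "(\<Sum>l\<in>I. q2 i l * q2 j l) = of_bool (i = j)" using I by (auto simp: q2z)
    have "(\<Sum>l\<in>J. q2 l i * q2 l j) = of_bool (i = j \<and> i \<noteq> z)"
    proof (cases "i \<in> J \<and> j \<in> J")
      case True
      then have "(\<Sum>l\<in>J. q2 l i * q2 l j) = (\<Sum>l\<in>J. q' l i * q' l j)"
        by (intro sum.cong refl) (simp add: q2J)
      then show ?thesis using q' True neJ by (simp add: orth_on_def)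
    qed (use ij I neJ in \<open>auto simp: q2z\<close>)
    then show "(\<Sum>l\<in>I. q2 l i * q2 l j) = of_bool (i = j)" using I by (auto simp: q2z)
  qed
  have K2: "K i j = (\<Sum>l\<in>I. e l * (q2 i l * q2 j l))" if ij: "i \<in> I" "j \<in> I" for i j
  proof (cases "i = z \<or> j = z")
    case True
    have "(\<Sum>l\<in>J. e l * (q2 i l * q2 j l)) = 0"
      using True I(2) by (intro sum.neutral) (auto simp: q2z)
    moreover have "K i j = c * of_bool (i = j)"
      using True Kz[OF ij(1)] Kz[OF ij(2)] Ksym[of i j] by auto
    ultimately show ?thesis using True I by (auto simp: q2z e_def)
  next
    case False
    then have "i \<in> J" "j \<in> J" using ij by (auto simp: J_def)
    moreover from this have "(\<Sum>l\<in>J. e l * (q2 i l * q2 j l)) = (\<Sum>l\<in>J. e' l * (q' i l * q' j l))"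
      by (intro sum.cong refl) (simp add: q2J)
    ultimately show ?thesis using False I K by (simp add: q2z)
  qed
  define q where "q i l = (\<Sum>j\<in>I. H i j * q2 j l)" for i l
  have oq: "orth_on I q"
    unfolding q_def by (rule orth_on_mult[OF fin H(1) orth2])
  have qz: "q i z = v i" if "i \<in> I" for i
    using that fin z H(3) by (simp add: q_def q2z)
  have "S i j = (\<Sum>l\<in>I. e l * (q i l * q j l))" if ij: "i \<in> I" "j \<in> I" for i j
  proof -
    \<comment> \<open>Being symmetric and orthogonal, \<open>H\<close> is its own inverse, so
      conjugating \<open>K\<close> by \<open>H\<close> returns \<open>S\<close>.\<close>
    have HH: "(\<Sum>m\<in>I. H i m * H m p) = of_bool (i = p)" if "i \<in> I" "p \<in> I" for i p
      using H(1) that by (simp add: orth_on_def H(2)[of _ p])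
    have "(\<Sum>m\<in>I. H i m * (e l * q2 m l)) = e l * (\<Sum>m\<in>I. H i m * q2 m l)" for l
      by (simp add: sum_distrib_left mult.left_commute)
    then have "(\<Sum>l\<in>I. e l * (q i l * q j l))
        = (\<Sum>l\<in>I. (\<Sum>m\<in>I. H i m * (e l * q2 m l)) * (\<Sum>m\<in>I. H j m * q2 m l))"
      by (simp add: q_def mult.assoc)
    also have "\<dots> = (\<Sum>m\<in>I. H i m * (\<Sum>m'\<in>I. H j m' * K m m'))"
      unfolding sum_prod_sums by (simp add: K2 mult_ac)
    also have "\<dots> = (\<Sum>m\<in>I. H i m * (\<Sum>p\<in>I. H m p * S p j))"
    proof (rule sum.cong[OF refl], rule arg_cong2[of _ _ _ _ "(*)", OF refl])
      fix m assume m: "m \<in> I"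
      have "(\<Sum>m'\<in>I. H j m' * K m m')
          = (\<Sum>m'\<in>I. \<Sum>p\<in>I. H m p * (\<Sum>r\<in>I. H j m' * (H r m' * S p r)))"
        by (simp add: K_def sum_distrib_left mult_ac)
      also have "\<dots> = (\<Sum>p\<in>I. \<Sum>m'\<in>I. H m p * (\<Sum>r\<in>I. H j m' * (H r m' * S p r)))"
        by (rule sum.swap)
      also have "\<dots> = (\<Sum>p\<in>I. H m p * (\<Sum>m'\<in>I. \<Sum>r\<in>I. H j m' * (H r m' * S p r)))"
        by (simp add: sum_distrib_left)
      also have "\<dots> = (\<Sum>p\<in>I. H m p * (\<Sum>r\<in>I. \<Sum>m'\<in>I. H j m' * (H r m' * S p r)))"
        by (rule sum.cong[OF refl]) (rule arg_cong2[of _ _ _ _ "(*)", OF refl sum.swap])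
      also have "\<dots> = (\<Sum>p\<in>I. H m p * (\<Sum>r\<in>I. S p r * (\<Sum>m'\<in>I. H j m' * H r m')))"
        by (simp add: sum_distrib_left mult_ac)
      also have "\<dots> = (\<Sum>p\<in>I. H m p * (\<Sum>r\<in>I. S p r * of_bool (j = r)))"
        using H(1) ij by (simp add: orth_on_def)
      also have "\<dots> = (\<Sum>p\<in>I. H m p * S p j)" using fin ij by simp
      finally show "(\<Sum>m'\<in>I. H j m' * K m m') = \<dots>" .
    qed
    also have "\<dots> = (\<Sum>m\<in>I. \<Sum>p\<in>I. S p j * (H i m * H m p))"
      by (simp add: sum_distrib_left mult_ac)
    also have "\<dots> = (\<Sum>p\<in>I. S p j * (\<Sum>m\<in>I. H i m * H m p))"
      by (subst sum.swap) (simp add: sum_distrib_left)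
    also have "\<dots> = S i j" using fin ij by (simp add: HH)
    finally show ?thesis by simp
  qed
  then show ?case using oq qz by (intro exI[of _ q] exI[of _ e]) (simp add: e_def)
qed

section \<open>Characteristic polynomials of diagonalised matrices\<close>

text \<open>\<open>A\<close> is similar to a diagonal matrix. The factors \<open>p\<close> and
  \<open>y\<close> are merely inverse to each other, not transposes, since the random-walk Laplacian
  is not symmetric. For square matrices a one-sided inverse is two-sided, so one product relation is
  enough.\<close>

lemma char_poly_diagonalised:
  fixes A :: "'b :: field mat"
  assumes A: "A \<in> carrier_mat n n" and f: "bij_betw f {..<n} I"
    and ent: "\<And>r s. r < n \<Longrightarrow> s < n \<Longrightarrow> A $$ (r, s) = (\<Sum>l\<in>I. p (f r) l * (e l * y l (f s)))"
    and inv: "\<And>i j. i \<in> I \<Longrightarrow> j \<in> I \<Longrightarrow> (\<Sum>l\<in>I. p i l * y l j) = of_bool (i = j)"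
  shows "char_poly A = (\<Prod>l\<in>I. [:- e l, 1:])"
proof -
  define P where "P = Matrix.mat n n (\<lambda>(r, s). p (f r) (f s))"
  define Y where "Y = Matrix.mat n n (\<lambda>(r, s). y (f r) (f s))"
  define E where "E = mat_diag n (\<lambda>r. e (f r))"
  have car: "P \<in> carrier_mat n n" "Y \<in> carrier_mat n n" "E \<in> carrier_mat n n"
    by (simp_all add: P_def Y_def E_def)
  have f': "bij_betw f {0..<n} I" using f by (simp add: lessThan_atLeast0)
  have fI: "f r \<in> I" if "r < n" for r using f that by (auto simp: bij_betw_def)
  have inj: "f r = f s \<longleftrightarrow> r = s" if "r < n" "s < n" for r s
    using f that by (auto simp: bij_betw_def inj_on_def)
  have PY: "P * Y = 1\<^sub>m n"
  proof (rule eq_matI)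
    fix r s assume "r < dim_row (1\<^sub>m n :: 'b mat)" "s < dim_col (1\<^sub>m n :: 'b mat)"
    then have rs: "r < n" "s < n" by simp_all
    have "(P * Y) $$ (r, s) = (\<Sum>t\<in>{0..<n}. p (f r) (f t) * y (f t) (f s))"
      using rs by (simp add: P_def Y_def scalar_prod_def)
    also have "\<dots> = (\<Sum>l\<in>I. p (f r) l * y l (f s))"
      by (rule sum.reindex_bij_betw[OF f'])
    also have "\<dots> = 1\<^sub>m n $$ (r, s)"
      using rs fI inj by (simp add: inv)
    finally show "(P * Y) $$ (r, s) = 1\<^sub>m n $$ (r, s)" .
  qed (simp_all add: P_def Y_def)
  have YP: "Y * P = 1\<^sub>m n" by (rule mat_mult_left_right_inverse[OF car(1,2) PY])
  have "A = P * E * Y"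
  proof (rule eq_matI)
    fix r s assume "r < dim_row (P * E * Y)" "s < dim_col (P * E * Y)"
    then have rs: "r < n" "s < n" by (simp_all add: P_def Y_def)
    have "(P * E * Y) $$ (r, s) = (\<Sum>t\<in>{0..<n}. p (f r) (f t) * (e (f t) * y (f t) (f s)))"
      using rs unfolding E_def mat_diag_mult_right[OF car(1)]
      by (simp add: P_def Y_def scalar_prod_def mult.assoc)
    also have "\<dots> = (\<Sum>l\<in>I. p (f r) l * (e l * y l (f s)))"
      by (rule sum.reindex_bij_betw[OF f'])
    finally show "A $$ (r, s) = (P * E * Y) $$ (r, s)" using ent rs by simp
  qed (use A in \<open>simp_all add: P_def Y_def\<close>)
  then have "similar_mat A E"
    using A car PY YP by (intro similar_matI[of _ _ P Y n]) auto
  then have "char_poly A = char_poly E" by (rule char_poly_similar)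
  also have "\<dots> = (\<Prod>a\<leftarrow>diag_mat E. [:- a, 1:])"
    by (rule char_poly_upper_triangular[OF car(3)]) (auto simp: E_def mat_diag_def)
  also have "diag_mat E = map (\<lambda>r. e (f r)) [0..<n]"
    by (simp add: diag_mat_def E_def mat_diag_def)
  also have "(\<Prod>a\<leftarrow>map (\<lambda>r. e (f r)) [0..<n]. [:- a, 1:]) = (\<Prod>r\<in>{0..<n}. [:- e (f r), 1:])"
    by (simp add: prod.distinct_set_conv_list[symmetric] comp_def)
  also have "\<dots> = (\<Prod>l\<in>I. [:- e l, 1:])" by (rule prod.reindex_bij_betw[OF f'])
  finally show ?thesis .
qed

text \<open>The \<open>m\<close> copies of the lower bound \<open>c\<close> come first in the sorted
  list; counting from 0, position \<open>m\<close> is the first that belongs to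
  \<open>M\<close>.\<close>

lemma nth_sorted_list_of_replicate_mset:
  fixes M :: "'a :: linorder multiset"
  assumes "M \<noteq> {#}" and le: "\<And>x. x \<in># M \<Longrightarrow> c \<le> x"
  shows "sorted_list_of_multiset (replicate_mset m c + M) ! m = Min (set_mset M)"
proof -
  define ys where "ys = sorted_list_of_multiset M"
  have ys: "sorted ys" "set ys = set_mset M" "mset ys = M" by (simp_all add: ys_def)
  have "ys \<noteq> []" using ys(3) assms(1) by auto
  then obtain y zs where yz: "ys = y # zs" by (cases ys) auto
  have "sorted (replicate m c @ ys)" using ys le by (auto simp: sorted_append)
  then have "sort (replicate m c @ ys) = replicate m c @ ys" by (rule sorted_sort_id)
  moreover have "replicate_mset m c + M = mset (replicate m c @ ys)" using ys by simp
  ultimately have "sorted_list_of_multiset (replicate_mset m c + M) = replicate m c @ ys"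
    by (simp only: sorted_list_of_multiset_mset)
  then have "sorted_list_of_multiset (replicate_mset m c + M) ! m = y"
    by (simp add: nth_append yz)
  also have "y = Min (set_mset M)"
    unfolding ys(2)[symmetric] yz by (rule Min_eqI[symmetric]) (use ys(1) yz in auto)
  finally show ?thesis .
qed

text \<open>\<open>K\<close> collects indices at which a zero eigenvalue is known. All eigenvalues
  are nonnegative, so these zeros come first and the next one in order is the minimum over the
  remaining indices, which may again be zero. \<open>K = I\<close> is the case in which the matrix
  has too few rows.\<close>

lemma lambda_diagonalised:
  assumes A: "A \<in> carrier_mat n n" and I: "finite I" "card I = n"
    and cp: "char_poly A = (\<Prod>l\<in>I. [:- e l, 1:])"
    and K: "K \<subseteq> I" "\<And>l. l \<in> K \<Longrightarrow> e l = 0" and pos: "\<And>l. l \<in> I \<Longrightarrow> 0 \<le> e l"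
  shows "lambda (card K + 1) A = (if K = I then \<infinity> else ereal (Min (e ` (I - K))))"
proof (cases "K = I")
  case True
  then show ?thesis using A I by (simp add: lambda_def)
next
  case False
  then have "card K < n" using I K by (metis psubsetI psubset_card_mono)
  have fK: "finite K" using I K finite_subset by blast
  have "proots (char_poly A) = (\<Sum>l\<in>I. {#e l#})"
    unfolding cp by (subst proots_prod) auto
  also have "\<dots> = (\<Sum>l\<in>K. {#e l#}) + (\<Sum>l\<in>I - K. {#e l#})"
    using I K by (metis add.commute sum.subset_diff)
  also have "(\<Sum>l\<in>K. {#e l#}) = replicate_mset (card K) 0"
    using K(2) fK by (simp add: multiset_eq_iff count_sum)
  finally have roots: "proots (char_poly A) = replicate_mset (card K) 0 + image_mset e (mset_set (I - K))"
    by (simp add: sum_unfold_sum_mset)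
  have ne: "mset_set (I - K) \<noteq> {#}" using False I K by (auto simp: mset_set_empty_iff)
  have "sorted_list_of_multiset (proots (char_poly A)) ! card K
      = Min (set_mset (image_mset e (mset_set (I - K))))"
    unfolding roots by (rule nth_sorted_list_of_replicate_mset) (use ne I pos in auto)
  then show ?thesis using \<open>card K < n\<close> A False I by (simp add: lambda_def)
qed

section \<open>Dirichlet forms and clustered weighted graphs\<close>

text \<open>For symmetric weights this is the bilinear form of the graph Laplacian. In this
  unsymmetrised form, summation over Gram vectors directly produces differences of entries of the
  Gram matrix.\<close>

definition dirichlet :: "'a set \<Rightarrow> ('a \<Rightarrow> 'a \<Rightarrow> real) \<Rightarrow> ('a \<Rightarrow> real) \<Rightarrow> ('a \<Rightarrow> real) \<Rightarrow> real" where
  "dirichlet V s x y = (\<Sum>i\<in>V. \<Sum>j\<in>V. s i j * (x i * y i - x i * y j))"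

lemma dirichlet_symmetrised:
  assumes "\<And>i j. i \<in> V \<Longrightarrow> j \<in> V \<Longrightarrow> s i j = s j i"
  shows "2 * dirichlet V s x y = (\<Sum>i\<in>V. \<Sum>j\<in>V. s i j * ((x i - x j) * (y i - y j)))"
proof -
  have "dirichlet V s x y = (\<Sum>j\<in>V. \<Sum>i\<in>V. s i j * (x i * y i - x i * y j))"
    unfolding dirichlet_def by (rule sum.swap)
  also have "\<dots> = (\<Sum>i\<in>V. \<Sum>j\<in>V. s i j * (x j * y j - x j * y i))"
    by (intro sum.cong refl) (simp add: assms)
  finally have "2 * dirichlet V s x y = (\<Sum>i\<in>V. \<Sum>j\<in>V. s i j * (x i * y i - x i * y j))
      + (\<Sum>i\<in>V. \<Sum>j\<in>V. s i j * (x j * y j - x j * y i))"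
    by (simp add: dirichlet_def)
  then show ?thesis by (simp add: algebra_simps flip: sum.distrib)
qed

lemma dirichlet_nonneg:
  assumes "\<And>i j. i \<in> V \<Longrightarrow> j \<in> V \<Longrightarrow> s i j = s j i" "\<And>i j. i \<in> V \<Longrightarrow> j \<in> V \<Longrightarrow> 0 \<le> s i j"
  shows "0 \<le> dirichlet V s x x"
proof -
  have "0 \<le> (\<Sum>i\<in>V. \<Sum>j\<in>V. s i j * ((x i - x j) * (x i - x j)))"
    by (intro sum_nonneg mult_nonneg_nonneg[OF assms(2)] zero_le_square)
  then show ?thesis using dirichlet_symmetrised[of V s x x, OF assms(1)] by simp
qed

lemma dirichlet_commute:
  assumes "\<And>i j. i \<in> V \<Longrightarrow> j \<in> V \<Longrightarrow> s i j = s j i"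
  shows "dirichlet V s x y = dirichlet V s y x"
  using dirichlet_symmetrised[of V s x y, OF assms] dirichlet_symmetrised[of V s y x, OF assms]
  by (simp add: mult.commute)

text \<open>This is nonnegativity of the form at \<open>x - m\<close>, expanded. It trades the
  quadratic dependence on \<open>x\<close> for terms in which at least one argument is
  \<open>m\<close>.\<close>

lemma dirichlet_ge_polar:
  assumes "\<And>i j. i \<in> V \<Longrightarrow> j \<in> V \<Longrightarrow> s i j = s j i" "\<And>i j. i \<in> V \<Longrightarrow> j \<in> V \<Longrightarrow> 0 \<le> s i j"
  shows "2 * dirichlet V s x m - dirichlet V s m m \<le> dirichlet V s x x"
proof -
  have "dirichlet V s (\<lambda>i. x i - m i) (\<lambda>i. x i - m i)
      = dirichlet V s x x - dirichlet V s x m - dirichlet V s m x + dirichlet V s m m"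
    unfolding dirichlet_def sum.distrib[symmetric] sum_subtractf[symmetric]
    by (intro sum.cong refl) (simp add: algebra_simps)
  then show ?thesis
    using dirichlet_nonneg[of V s "\<lambda>i. x i - m i", OF assms] dirichlet_commute[of V s x m, OF assms(1)]
    by simp
qed

lemma sum_dirichlet:
  "(\<Sum>l\<in>L. dirichlet V s (x l) (y l))
    = (\<Sum>i\<in>V. \<Sum>j\<in>V. s i j * ((\<Sum>l\<in>L. x l i * y l i) - (\<Sum>l\<in>L. x l i * y l j)))"
proof -
  have "(\<Sum>l\<in>L. dirichlet V s (x l) (y l))
      = (\<Sum>i\<in>V. \<Sum>l\<in>L. \<Sum>j\<in>V. s i j * (x l i * y l i - x l i * y l j))"
    unfolding dirichlet_def by (rule sum.swap)
  also have "\<dots> = (\<Sum>i\<in>V. \<Sum>j\<in>V. \<Sum>l\<in>L. s i j * (x l i * y l i - x l i * y l j))"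
    by (rule sum.cong[OF refl]) (rule sum.swap)
  finally show ?thesis by (simp add: sum_subtractf flip: sum_distrib_left)
qed

section \<open>Degrees, volumes, means and variances of a clustered weighted graph\<close>

locale clustered_graph =
  fixes V :: "'a set" and w :: "'a \<Rightarrow> 'a \<Rightarrow> real" and c :: "'a \<Rightarrow> 'b"
  assumes finite_V [simp]: "finite V"
    and w_sym: "\<And>i j. i \<in> V \<Longrightarrow> j \<in> V \<Longrightarrow> w i j = w j i"
    and w_nonneg: "\<And>i j. i \<in> V \<Longrightarrow> j \<in> V \<Longrightarrow> 0 \<le> w i j"
    and deg_in_pos: "\<And>i. i \<in> V \<Longrightarrow> 0 < (\<Sum>j\<in>{j\<in>V. c j = c i}. w i j)"
begin

text \<open>Clusters are level sets of the labelling \<open>c\<close>, so they are disjoint and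
  cover \<open>V\<close> by construction.\<close>

definition cluster :: "'b \<Rightarrow> 'a set" where "cluster a = {j\<in>V. c j = a}"
definition w_in :: "'a \<Rightarrow> 'a \<Rightarrow> real" where "w_in i j = (if c i = c j then w i j else 0)"
definition w_out :: "'a \<Rightarrow> 'a \<Rightarrow> real" where "w_out i j = (if c i = c j then 0 else w i j)"
definition deg :: "'a \<Rightarrow> real" where "deg i = (\<Sum>j\<in>V. w i j)"
definition deg_in :: "'a \<Rightarrow> real" where "deg_in i = (\<Sum>j\<in>V. w_in i j)"
definition deg_out :: "'a \<Rightarrow> real" where "deg_out i = (\<Sum>j\<in>V. w_out i j)"
definition vol :: "'b \<Rightarrow> real" where "vol a = (\<Sum>i\<in>cluster a. deg i)"
text \<open>Mean and variance use the full degree \<open>deg\<close>, the weight that occurs in the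
  row constraint of the program. The spectral gap refers to \<open>deg_in\<close> instead;
  \<open>poincare\<close> reconciles the two.\<close>

definition mean :: "('a \<Rightarrow> real) \<Rightarrow> 'b \<Rightarrow> real" where
  "mean x a = (\<Sum>i\<in>cluster a. deg i * x i) / vol a"
definition variance :: "('a \<Rightarrow> real) \<Rightarrow> real" where
  "variance x = (\<Sum>i\<in>V. deg i * (x i - mean x (c i))\<^sup>2)"

lemma cluster_simps [simp]: "finite (cluster a)" "i \<in> V \<Longrightarrow> i \<in> cluster (c i)"
  by (simp_all add: cluster_def)

lemma in_cluster: "i \<in> cluster a \<longleftrightarrow> i \<in> V \<and> c i = a" by (simp add: cluster_def)

lemma sum_by_cluster: "sum f V = (\<Sum>a\<in>c ` V. sum f (cluster a))"
  unfolding cluster_def by (rule sum.image_gen) simp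

lemma sum_cluster: "sum f (cluster a) = (\<Sum>i\<in>V. if c i = a then f i else 0)"
  unfolding cluster_def by (rule sum.inter_filter) simp

lemma w_split: "w i j = w_in i j + w_out i j" by (simp add: w_in_def w_out_def)

lemma w_in_out_sym:
  assumes "i \<in> V" "j \<in> V" shows "w_in i j = w_in j i" "w_out i j = w_out j i"
  using w_sym[OF assms] by (simp_all add: w_in_def w_out_def)

lemma w_in_out_nonneg:
  assumes "i \<in> V" "j \<in> V" shows "0 \<le> w_in i j" "0 \<le> w_out i j"
  using w_nonneg[OF assms] by (simp_all add: w_in_def w_out_def)

lemma deg_split: "deg i = deg_in i + deg_out i"
  unfolding deg_def deg_in_def deg_out_def sum.distrib[symmetric]
  by (intro sum.cong refl) (rule w_split)

lemma deg_in_eq: "deg_in i = (\<Sum>j\<in>cluster (c i). w i j)"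
  unfolding sum_cluster deg_in_def w_in_def by (intro sum.cong refl) auto

lemma deg_in_gt_0: "i \<in> V \<Longrightarrow> 0 < deg_in i"
  using deg_in_pos[of i] by (simp add: deg_in_eq cluster_def)

lemma deg_out_nonneg: "i \<in> V \<Longrightarrow> 0 \<le> deg_out i"
  unfolding deg_out_def by (intro sum_nonneg w_in_out_nonneg)

lemma deg_pos: "i \<in> V \<Longrightarrow> 0 < deg i"
  using deg_in_gt_0 deg_out_nonneg by (simp add: deg_split add_pos_nonneg)

lemma vol_pos: "i \<in> V \<Longrightarrow> 0 < vol (c i)"
  unfolding vol_def by (rule sum_pos) (auto simp: in_cluster deg_pos)

text \<open>Each cluster contributes exactly 1. This is the value that the trace constraint
  prescribes.\<close>

lemma sum_inverse_vol: "(\<Sum>i\<in>V. deg i / vol (c i)) = card (c ` V)"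
proof -
  have "(\<Sum>i\<in>V. deg i / vol (c i)) = (\<Sum>a\<in>c ` V. \<Sum>i\<in>cluster a. deg i / vol a)"
    unfolding sum_by_cluster by (intro sum.cong refl) (simp add: in_cluster)
  also have "\<dots> = (\<Sum>a\<in>c ` V. 1)"
  proof (rule sum.cong[OF refl])
    fix a assume "a \<in> c ` V"
    then have "vol a \<noteq> 0" using vol_pos by force
    then show "(\<Sum>i\<in>cluster a. deg i / vol a) = 1"
      unfolding sum_divide_distrib[symmetric] vol_def[symmetric] by simp
  qed
  finally show ?thesis by simp
qed

text \<open>The residual \<open>x - mean\<close> is orthogonal, with weight \<open>deg\<close>, to
  every function that is constant on clusters, hence to the mean itself.\<close>

lemma variance_eq: "variance x = (\<Sum>i\<in>V. deg i * (x i * x i)) - (\<Sum>i\<in>V. deg i * (x i * mean x (c i)))"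
proof -
  have "(\<Sum>i\<in>V. deg i * ((x i - mean x (c i)) * mean x (c i)))
      = (\<Sum>a\<in>c ` V. \<Sum>i\<in>cluster a. (deg i * x i - mean x a * deg i) * mean x a)"
    unfolding sum_by_cluster by (intro sum.cong refl) (simp add: in_cluster algebra_simps)
  also have "\<dots> = 0"
  proof (rule sum.neutral, rule ballI)
    fix a assume "a \<in> c ` V"
    then have "vol a \<noteq> 0" using vol_pos by force
    then have "mean x a * vol a = (\<Sum>i\<in>cluster a. deg i * x i)" by (simp add: mean_def)
    moreover have "(\<Sum>i\<in>cluster a. (deg i * x i - mean x a * deg i) * mean x a)
        = ((\<Sum>i\<in>cluster a. deg i * x i) - mean x a * vol a) * mean x a"
      unfolding vol_def sum_distrib_left[of "mean x a"] sum_subtractf[symmetric] sum_distrib_right ..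
    ultimately show "(\<Sum>i\<in>cluster a. (deg i * x i - mean x a * deg i) * mean x a) = 0" by simp
  qed
  finally have "(\<Sum>i\<in>V. deg i * ((x i - mean x (c i)) * mean x (c i))) = 0" .
  then have "variance x = variance x + (\<Sum>i\<in>V. deg i * ((x i - mean x (c i)) * mean x (c i)))"
    by simp
  also have "\<dots> = (\<Sum>i\<in>V. deg i * (x i * x i)) - (\<Sum>i\<in>V. deg i * (x i * mean x (c i)))"
    unfolding variance_def sum.distrib[symmetric] sum_subtractf[symmetric]
    by (intro sum.cong refl) (simp add: power2_eq_square algebra_simps)
  finally show ?thesis .
qed

end

section \<open>Feasible points of the semidefinite program\<close>

text \<open>\<open>Y\<close> is a feasible \<open>Z\<close> divided entrywise by \<open>\<surd>d\<^sub>i \<surd>d\<^sub>j\<close>, given together with Gram vectors, so that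
  every inequality between quadratic forms can be summed over \<open>l\<close>.\<close>

locale sdp_point = clustered_graph V w c
  for V :: "'a set" and w :: "'a \<Rightarrow> 'a \<Rightarrow> real" and c :: "'a \<Rightarrow> 'b" +
  fixes Y :: "'a \<Rightarrow> 'a \<Rightarrow> real" and x :: "'l \<Rightarrow> 'a \<Rightarrow> real" and L :: "'l set"
  assumes finite_L [simp]: "finite L"
    and gram: "\<And>i j. i \<in> V \<Longrightarrow> j \<in> V \<Longrightarrow> Y i j = (\<Sum>l\<in>L. x l i * x l j)"
    and Y_nonneg: "\<And>i j. i \<in> V \<Longrightarrow> j \<in> V \<Longrightarrow> 0 \<le> Y i j"
    and Y_row: "\<And>i. i \<in> V \<Longrightarrow> (\<Sum>j\<in>V. deg j * Y i j) = 1"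
    and Y_trace: "(\<Sum>i\<in>V. deg i * Y i i) = card (c ` V)"
begin

text \<open>The weighted row sums of \<open>Y\<close> are 1, so this is the fraction of row
  \<open>i\<close> lying outside its own cluster. \<open>total_leak\<close> adds up the averages of
  \<open>leak\<close> over the clusters; it is the quantity \<open>t\<close> of the outline.\<close>

definition leak :: "'a \<Rightarrow> real" where "leak i = (\<Sum>j\<in>V. if c j = c i then 0 else deg j * Y i j)"
definition total_leak :: real where "total_leak = (\<Sum>i\<in>V. deg i * leak i / vol (c i))"

lemma Y_sym: "i \<in> V \<Longrightarrow> j \<in> V \<Longrightarrow> Y i j = Y j i"
  by (simp add: gram mult.commute)

lemma leak_nonneg: "i \<in> V \<Longrightarrow> 0 \<le> leak i"
  unfolding leak_def by (intro sum_nonneg) (simp add: less_imp_le[OF deg_pos] Y_nonneg)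

lemma leak_term_nonneg: "i \<in> V \<Longrightarrow> 0 \<le> deg i * leak i / vol (c i)"
  by (intro divide_nonneg_nonneg mult_nonneg_nonneg less_imp_le vol_pos deg_pos leak_nonneg)

lemma total_leak_nonneg: "0 \<le> total_leak"
  unfolding total_leak_def by (intro sum_nonneg leak_term_nonneg)

lemma Y_cluster_row: "i \<in> V \<Longrightarrow> (\<Sum>j\<in>cluster (c i). deg j * Y i j) = 1 - leak i"
proof -
  assume i: "i \<in> V"
  have "(\<Sum>j\<in>cluster (c i). deg j * Y i j) + leak i = (\<Sum>j\<in>V. deg j * Y i j)"
    unfolding sum_cluster leak_def sum.distrib[symmetric] by (intro sum.cong refl) simp
  then show ?thesis using Y_row[OF i] by simp
qed

lemma sum_x_mean:
  assumes "i \<in> V"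
  shows "(\<Sum>l\<in>L. x l i * mean (x l) a) = (\<Sum>j\<in>cluster a. deg j * Y i j) / vol a"
proof -
  have "(\<Sum>l\<in>L. x l i * mean (x l) a) = (\<Sum>l\<in>L. \<Sum>j\<in>cluster a. deg j * (x l i * x l j)) / vol a"
    by (simp add: mean_def sum_distrib_left sum_divide_distrib mult_ac)
  also have "(\<Sum>l\<in>L. \<Sum>j\<in>cluster a. deg j * (x l i * x l j)) = (\<Sum>j\<in>cluster a. \<Sum>l\<in>L. deg j * (x l i * x l j))"
    by (rule sum.swap)
  also have "\<dots> = (\<Sum>j\<in>cluster a. deg j * Y i j)"
    by (intro sum.cong refl) (use assms in \<open>simp add: in_cluster gram sum_distrib_left\<close>)
  finally show ?thesis .
qed

lemma sum_mean_mean: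
  "(\<Sum>l\<in>L. mean (x l) a * mean (x l) b) = (\<Sum>i\<in>cluster a. deg i * (\<Sum>l\<in>L. x l i * mean (x l) b)) / vol a"
proof -
  have "(\<Sum>l\<in>L. mean (x l) a * mean (x l) b)
      = (\<Sum>l\<in>L. \<Sum>i\<in>cluster a. deg i * (x l i * mean (x l) b)) / vol a"
    unfolding mean_def[of _ a] by (simp add: sum_distrib_left sum_distrib_right sum_divide_distrib mult_ac)
  also have "(\<Sum>l\<in>L. \<Sum>i\<in>cluster a. deg i * (x l i * mean (x l) b))
      = (\<Sum>i\<in>cluster a. \<Sum>l\<in>L. deg i * (x l i * mean (x l) b))" by (rule sum.swap)
  finally show ?thesis by (simp add: sum_distrib_left)
qed

text \<open>In \<open>variance_eq\<close> the first sum becomes the trace, and the second becomes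
  the number of clusters minus \<open>total_leak\<close>. The trace constraint makes the numbers of
  clusters cancel.\<close>

lemma sum_variance: "(\<Sum>l\<in>L. variance (x l)) = total_leak"
proof -
  have "(\<Sum>l\<in>L. \<Sum>i\<in>V. deg i * (x l i * x l i)) = (\<Sum>i\<in>V. deg i * Y i i)"
    by (subst sum.swap) (simp add: gram sum_distrib_left)
  moreover have "(\<Sum>l\<in>L. \<Sum>i\<in>V. deg i * (x l i * mean (x l) (c i)))
      = (\<Sum>i\<in>V. deg i * (\<Sum>l\<in>L. x l i * mean (x l) (c i)))"
    by (subst sum.swap) (simp add: sum_distrib_left)
  moreover have "\<dots> = (\<Sum>i\<in>V. deg i / vol (c i) - deg i * leak i / vol (c i))"
    by (intro sum.cong refl) (simp add: sum_x_mean Y_cluster_row right_diff_distrib diff_divide_distrib)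
  ultimately show ?thesis
    by (simp add: variance_eq sum_subtractf Y_trace sum_inverse_vol total_leak_def)
qed

lemma energy_in_ge:
  assumes "\<And>f. \<mu> * variance f \<le> dirichlet V w_in f f"
  shows "\<mu> * total_leak \<le> (\<Sum>i\<in>V. \<Sum>j\<in>V. w_in i j * (Y i i - Y i j))"
proof -
  have "\<mu> * total_leak = (\<Sum>l\<in>L. \<mu> * variance (x l))"
    by (simp add: sum_variance sum_distrib_left[symmetric])
  also have "\<dots> \<le> (\<Sum>l\<in>L. dirichlet V w_in (x l) (x l))" by (intro sum_mono assms)
  also have "\<dots> = (\<Sum>i\<in>V. \<Sum>j\<in>V. w_in i j * (Y i i - Y i j))"
    unfolding sum_dirichlet by (simp add: gram)
  finally show ?thesis .
qed

text \<open>Each term pairs an edge from \<open>i\<close> into another cluster with a vertex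
  \<open>p\<close> of that cluster, so \<open>Y i p\<close> lies outside the diagonal blocks. For
  fixed \<open>i\<close> and \<open>p\<close> the edge weights add up to at most
  \<open>deg_out i\<close>. What remains is, by symmetry of \<open>Y\<close>, the leak at
  \<open>p\<close> averaged over the cluster of \<open>p\<close>.\<close>

lemma cross_term_le:
  assumes eps: "\<And>i. i \<in> V \<Longrightarrow> deg_out i \<le> \<epsilon> * deg i"
  shows "(\<Sum>i\<in>V. \<Sum>j\<in>V. w_out i j * ((\<Sum>p\<in>cluster (c j). deg p * Y i p) / vol (c j))) \<le> \<epsilon> * total_leak"
proof -
  have "(\<Sum>i\<in>V. \<Sum>j\<in>V. w_out i j * ((\<Sum>p\<in>cluster (c j). deg p * Y i p) / vol (c j)))
      = (\<Sum>i\<in>V. \<Sum>j\<in>V. \<Sum>p\<in>V. if c p = c j then w_out i j * (deg p * Y i p / vol (c p)) else 0)"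
    unfolding sum_cluster sum_divide_distrib sum_distrib_left
    by (intro sum.cong refl) simp
  also have "\<dots> = (\<Sum>i\<in>V. \<Sum>p\<in>V. \<Sum>j\<in>V. if c p = c j then w_out i j * (deg p * Y i p / vol (c p)) else 0)"
    by (rule sum.cong[OF refl]) (rule sum.swap)
  \<comment> \<open>If \<open>i\<close> and \<open>p\<close> share a cluster, \<open>w_out\<close>
    vanishes on all \<open>j\<close> concerned; otherwise the sum over \<open>j\<close> in the
    cluster of \<open>p\<close> is enlarged to all of \<open>V\<close>.\<close>
  also have "\<dots> \<le> (\<Sum>i\<in>V. \<Sum>p\<in>V. if c i = c p then 0 else \<epsilon> * deg i * (deg p * Y i p / vol (c p)))"
  proof (intro sum_mono)
    fix i p assume ip: "i \<in> V" "p \<in> V"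
    have nn: "0 \<le> deg p * Y i p / vol (c p)"
      using ip by (intro divide_nonneg_nonneg mult_nonneg_nonneg less_imp_le vol_pos deg_pos Y_nonneg)
    show "(\<Sum>j\<in>V. if c p = c j then w_out i j * (deg p * Y i p / vol (c p)) else 0)
        \<le> (if c i = c p then 0 else \<epsilon> * deg i * (deg p * Y i p / vol (c p)))"
    proof (cases "c i = c p")
      case True
      then show ?thesis by (intro eq_refl) (simp add: w_out_def sum.neutral)
    next
      case False
      have "(\<Sum>j\<in>V. if c p = c j then w_out i j * (deg p * Y i p / vol (c p)) else 0)
          \<le> (\<Sum>j\<in>V. w_out i j * (deg p * Y i p / vol (c p)))"
        using mult_nonneg_nonneg[OF w_in_out_nonneg(2)[OF ip(1)] nn] by (intro sum_mono) auto
      also have "\<dots> = deg_out i * (deg p * Y i p / vol (c p))"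
        by (simp only: deg_out_def sum_distrib_right)
      also have "\<dots> \<le> \<epsilon> * deg i * (deg p * Y i p / vol (c p))"
        by (rule mult_right_mono[OF eps[OF ip(1)] nn])
      finally show ?thesis using False by simp
    qed
  qed
  also have "\<dots> = (\<Sum>p\<in>V. \<Sum>i\<in>V. if c i = c p then 0 else \<epsilon> * deg i * (deg p * Y i p / vol (c p)))"
    by (rule sum.swap)
  also have "\<dots> = \<epsilon> * total_leak"
    unfolding total_leak_def leak_def sum_distrib_left sum_divide_distrib
    by (intro sum.cong refl) (simp add: Y_sym mult_ac)
  finally show ?thesis .
qed

text \<open>\<open>dirichlet_ge_polar\<close> is applied to each Gram vector and its cluster means.
  The constant 4 splits evenly: the diagonal terms lose at most
  \<open>2 * \<epsilon> * total_leak\<close>, and so do the cross terms between vertices and means.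
  The cross terms between two means are nonnegative and are dropped.\<close>

lemma energy_out_ge:
  assumes eps: "\<And>i. i \<in> V \<Longrightarrow> deg_out i \<le> \<epsilon> * deg i"
  shows "(\<Sum>i\<in>V. deg_out i / vol (c i)) - 4 * \<epsilon> * total_leak
    \<le> (\<Sum>i\<in>V. \<Sum>j\<in>V. w_out i j * (Y i i - Y i j))"
proof -
  \<comment> \<open>\<open>R\<close> holds inner products of Gram vectors with cluster means,
    \<open>T\<close> those of two cluster means. Both are averages of entries of \<open>Y\<close>,
    which is where \<open>Y \<ge> 0\<close> enters.\<close>
  define R where "R i b = (\<Sum>l\<in>L. x l i * mean (x l) b)" for i b
  define T where "T a b = (\<Sum>l\<in>L. mean (x l) a * mean (x l) b)" for a b
  let ?m = "\<lambda>l i. mean (x l) (c i)"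
  have R: "R i b = (\<Sum>p\<in>cluster b. deg p * Y i p) / vol b" if "i \<in> V" for i b
    unfolding R_def by (rule sum_x_mean[OF that])
  have R_own: "R i (c i) = (1 - leak i) / vol (c i)" if "i \<in> V" for i
    by (simp add: R Y_cluster_row that)
  have T: "T a b = (\<Sum>i\<in>cluster a. deg i * R i b) / vol a" for a b
    unfolding T_def R_def by (rule sum_mean_mean)
  have R_nonneg: "0 \<le> R i (c j)" if "i \<in> V" "j \<in> V" for i j
    unfolding R[OF that(1)] using that
    by (intro divide_nonneg_nonneg sum_nonneg mult_nonneg_nonneg less_imp_le vol_pos deg_pos Y_nonneg)
       (auto simp: in_cluster)
  have T_nonneg: "0 \<le> T (c i) (c j)" if "i \<in> V" "j \<in> V" for i j
    unfolding T using that
    by (intro divide_nonneg_nonneg sum_nonneg mult_nonneg_nonneg less_imp_le vol_pos deg_pos R_nonneg)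
       (auto simp: in_cluster)
  have T_own: "T (c i) (c i) \<le> 1 / vol (c i)" if "i \<in> V" for i
  proof -
    have "T (c i) (c i) \<le> (\<Sum>j\<in>cluster (c i). deg j * (1 / vol (c i))) / vol (c i)"
      unfolding T
    proof (intro divide_right_mono sum_mono mult_left_mono)
      fix j assume "j \<in> cluster (c i)"
      then have j: "j \<in> V" "c j = c i" by (auto simp: in_cluster)
      then show "R j (c i) \<le> 1 / vol (c i)"
        using R_own[of j] leak_nonneg[of j] vol_pos[OF j(1)] by (simp add: divide_right_mono)
    qed (auto simp: in_cluster intro: less_imp_le deg_pos vol_pos that)
    also have "\<dots> = 1 / vol (c i)"
      using vol_pos[OF that] by (simp add: vol_def flip: sum_divide_distrib)
    finally show ?thesis .
  qed
  have "(\<Sum>i\<in>V. \<Sum>j\<in>V. w_out i j * (Y i i - Y i j)) = (\<Sum>l\<in>L. dirichlet V w_out (x l) (x l))"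
    unfolding sum_dirichlet by (simp add: gram)
  also have "\<dots> \<ge> (\<Sum>l\<in>L. 2 * dirichlet V w_out (x l) (?m l) - dirichlet V w_out (?m l) (?m l))"
    by (intro sum_mono dirichlet_ge_polar w_in_out_sym w_in_out_nonneg)
  also have "(\<Sum>l\<in>L. 2 * dirichlet V w_out (x l) (?m l) - dirichlet V w_out (?m l) (?m l))
      = 2 * (\<Sum>i\<in>V. \<Sum>j\<in>V. w_out i j * (R i (c i) - R i (c j)))
        - (\<Sum>i\<in>V. \<Sum>j\<in>V. w_out i j * (T (c i) (c i) - T (c i) (c j)))"
    by (simp add: sum_subtractf sum_distrib_left[symmetric] sum_dirichlet R_def T_def)
  also have "\<dots> = (\<Sum>i\<in>V. \<Sum>j\<in>V. w_out i j * (2 * R i (c i) - T (c i) (c i)))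
      + (\<Sum>i\<in>V. \<Sum>j\<in>V. w_out i j * T (c i) (c j)) - 2 * (\<Sum>i\<in>V. \<Sum>j\<in>V. w_out i j * R i (c j))"
    by (simp add: sum_distrib_left sum.distrib sum_subtractf algebra_simps)
  finally have 1: "(\<Sum>i\<in>V. \<Sum>j\<in>V. w_out i j * (2 * R i (c i) - T (c i) (c i)))
      + (\<Sum>i\<in>V. \<Sum>j\<in>V. w_out i j * T (c i) (c j)) - 2 * (\<Sum>i\<in>V. \<Sum>j\<in>V. w_out i j * R i (c j))
      \<le> (\<Sum>i\<in>V. \<Sum>j\<in>V. w_out i j * (Y i i - Y i j))" .
  have 2: "0 \<le> (\<Sum>i\<in>V. \<Sum>j\<in>V. w_out i j * T (c i) (c j))"
    by (intro sum_nonneg mult_nonneg_nonneg w_in_out_nonneg T_nonneg)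
  have 3: "(\<Sum>i\<in>V. \<Sum>j\<in>V. w_out i j * R i (c j)) \<le> \<epsilon> * total_leak"
    using cross_term_le[OF eps] by (simp add: R cong: sum.cong)
  have "(\<Sum>i\<in>V. deg_out i / vol (c i)) - 2 * (\<epsilon> * total_leak)
      = (\<Sum>i\<in>V. deg_out i / vol (c i) - 2 * (\<epsilon> * deg i * leak i / vol (c i)))"
    by (simp add: total_leak_def sum_subtractf sum_distrib_left mult.assoc)
  \<comment> \<open>Twice \<open>R i (c i) = (1 - leak i) / vol (c i)\<close> minus at most
    \<open>1 / vol (c i)\<close> leaves \<open>(1 - 2 * leak i) / vol (c i)\<close>.\<close>
  also have "\<dots> \<le> (\<Sum>i\<in>V. deg_out i * (2 * R i (c i) - T (c i) (c i)))"
  proof (rule sum_mono)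
    fix i assume i: "i \<in> V"
    have "deg_out i * (leak i / vol (c i)) \<le> \<epsilon> * deg i * (leak i / vol (c i))"
      using vol_pos[OF i] leak_nonneg[OF i] by (intro mult_right_mono eps i) simp
    moreover have "deg_out i * ((1 - 2 * leak i) / vol (c i)) \<le> deg_out i * (2 * R i (c i) - T (c i) (c i))"
      using T_own[OF i] R_own[OF i]
      by (intro mult_left_mono deg_out_nonneg i) (simp add: diff_divide_distrib)
    moreover have "deg_out i * ((1 - 2 * leak i) / vol (c i))
        = deg_out i / vol (c i) - 2 * (deg_out i * (leak i / vol (c i)))"
      by (simp add: diff_divide_distrib right_diff_distrib)
    ultimately show "deg_out i / vol (c i) - 2 * (\<epsilon> * deg i * leak i / vol (c i))
        \<le> deg_out i * (2 * R i (c i) - T (c i) (c i))" by simp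
  qed
  also have "\<dots> = (\<Sum>i\<in>V. \<Sum>j\<in>V. w_out i j * (2 * R i (c i) - T (c i) (c i)))"
    by (simp only: deg_out_def sum_distrib_right)
  finally show ?thesis using 1 2 3 by simp
qed

text \<open>Without leak, \<open>Y\<close> vanishes between clusters. The variances vanish too, so
  the Gram vectors are constant on clusters and each diagonal block of \<open>Y\<close> is constant;
  the row constraint then fixes the constant.\<close>

lemma no_leak_imp_ncut:
  assumes "total_leak = 0" and ij: "i \<in> V" "j \<in> V"
  shows "Y i j = (if c i = c j then 1 / vol (c i) else 0)"
proof -
  have leak: "leak i = 0" if "i \<in> V" for i
  proof -
    have "deg i * leak i / vol (c i) = 0"
      using assms(1) that leak_term_nonneg unfolding total_leak_def
      by (subst (asm) sum_nonneg_eq_0_iff) auto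
    then show ?thesis using deg_pos[OF that] vol_pos[OF that] by simp
  qed
  have var: "variance (x l) = 0" if "l \<in> L" for l
  proof -
    have "0 \<le> variance (x l)" for l
      unfolding variance_def by (intro sum_nonneg mult_nonneg_nonneg less_imp_le[OF deg_pos]) auto
    then show ?thesis using assms(1) that unfolding sum_variance[symmetric]
      by (subst (asm) sum_nonneg_eq_0_iff) auto
  qed
  have const: "x l p = mean (x l) (c p)" if "l \<in> L" "p \<in> V" for l p
  proof -
    have nn: "0 \<le> deg i * (x l i - mean (x l) (c i))\<^sup>2" if "i \<in> V" for i
      by (intro mult_nonneg_nonneg less_imp_le[OF deg_pos] that) simp
    have "deg p * (x l p - mean (x l) (c p))\<^sup>2 = 0"
      using sum_nonneg_0[OF finite_V nn _ that(2)] var[OF that(1)] by (simp add: variance_def)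
    then show ?thesis using deg_pos[OF that(2)] by simp
  qed
  have same: "Y i p = Y i i" if "p \<in> cluster (c i)" for p
  proof -
    have p: "p \<in> V" "c p = c i" using that by (auto simp: in_cluster)
    then have "x l p = x l i" if "l \<in> L" for l using const[OF that] ij by simp
    then show ?thesis using p ij by (simp add: gram)
  qed
  show ?thesis
  proof (cases "c i = c j")
    case True
    have "vol (c i) * Y i i = (\<Sum>p\<in>cluster (c i). deg p * Y i p)"
      by (simp add: same vol_def sum_distrib_right)
    also have "\<dots> = 1" by (simp add: Y_cluster_row leak ij)
    finally have "Y i i = 1 / vol (c i)" using vol_pos[OF ij(1)] by (simp add: field_simps)
    then show ?thesis using True same[of j] ij by (simp add: in_cluster)
  next
    case False
    have nn: "0 \<le> (if c p = c i then 0 else deg p * Y i p)" if "p \<in> V" for p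
      using that ij by (simp add: less_imp_le[OF deg_pos] Y_nonneg)
    have "(if c j = c i then 0 else deg j * Y i j) = 0"
      using leak[OF ij(1)] ij nn unfolding leak_def by (subst (asm) sum_nonneg_eq_0_iff) auto
    then show ?thesis using False deg_pos[OF ij(2)] by auto
  qed
qed

end

section \<open>Poincare inequality on the clusters\<close>

text \<open>The index set \<open>L\<close> of the rank-one terms is separate from \<open>I\<close>,
  because the cut point is later written with one such term per cluster.\<close>

lemma quadratic_form_diagonalised:
  fixes S :: "'a \<Rightarrow> 'a \<Rightarrow> real"
  assumes S: "\<And>i j. i \<in> I \<Longrightarrow> j \<in> I \<Longrightarrow> S i j = (\<Sum>l\<in>L. e l * (q i l * q j l))"
  shows "(\<Sum>i\<in>I. f i * (\<Sum>j\<in>I. S i j * f j)) = (\<Sum>l\<in>L. e l * (\<Sum>i\<in>I. q i l * f i)\<^sup>2)"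
proof -
  have "(\<Sum>l\<in>L. e l * (\<Sum>i\<in>I. q i l * f i)\<^sup>2)
      = (\<Sum>l\<in>L. (\<Sum>i\<in>I. f i * (e l * q i l)) * (\<Sum>j\<in>I. f j * q j l))"
    by (simp add: power2_eq_square sum_distrib_left mult_ac)
  also have "\<dots> = (\<Sum>i\<in>I. f i * (\<Sum>j\<in>I. f j * S i j))"
    unfolding sum_prod_sums by (intro sum.cong refl arg_cong2[of _ _ _ _ "(*)"]) (simp add: S mult_ac)
  finally show ?thesis by (simp add: mult.commute)
qed

text \<open>At column \<open>m\<close> of \<open>q\<close> every coefficient but the one of index
  \<open>m\<close> vanishes. Nonnegative forms thereby get nonnegative eigenvalues.\<close>

lemma eigenvalue_as_quadratic_form:
  fixes S :: "'a \<Rightarrow> 'a \<Rightarrow> real"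
  assumes "finite I" "orth_on I q" "m \<in> I"
    and S: "\<And>i j. i \<in> I \<Longrightarrow> j \<in> I \<Longrightarrow> S i j = (\<Sum>l\<in>I. e l * (q i l * q j l))"
  shows "e m = (\<Sum>i\<in>I. q i m * (\<Sum>j\<in>I. S i j * q j m))"
proof -
  have "(\<Sum>l\<in>I. e l * (\<Sum>i\<in>I. q i l * q i m)\<^sup>2) = (\<Sum>l\<in>I. e l * of_bool (l = m))"
    using assms by (intro sum.cong refl) (simp add: orth_on_def)
  also have "\<dots> = e m" using assms by simp
  finally show ?thesis using quadratic_form_diagonalised[of I S e q I "\<lambda>i. q i m"] S by simp
qed

text \<open>The identity matrix is diagonalised by \<open>q\<close> with all eigenvalues equal to
  1.\<close>

lemma parseval:
  assumes "finite I" "orth_on I q"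
  shows "(\<Sum>l\<in>I. (\<Sum>i\<in>I. q i l * f i)\<^sup>2) = (\<Sum>i\<in>I. (f i)\<^sup>2)"
proof -
  have "(\<Sum>i\<in>I. f i * (\<Sum>j\<in>I. of_bool (i = j) * f j)) = (\<Sum>l\<in>I. 1 * (\<Sum>i\<in>I. q i l * f i)\<^sup>2)"
    by (rule quadratic_form_diagonalised) (use assms in \<open>simp add: orth_on_def\<close>)
  then show ?thesis using assms(1) by (simp add: power2_eq_square)
qed

text \<open>The eigenvectors are scaled by the square roots of their eigenvalues; here
  \<open>x l\<close> is the \<open>l\<close>-th coordinate of all Gram vectors together.\<close>

lemma psd_imp_gram:
  fixes Y :: "'a \<Rightarrow> 'a \<Rightarrow> real"
  assumes fin: "finite I" and sym: "\<And>i j. i \<in> I \<Longrightarrow> j \<in> I \<Longrightarrow> Y i j = Y j i"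
    and psd: "\<And>f. 0 \<le> (\<Sum>i\<in>I. f i * (\<Sum>j\<in>I. Y i j * f j))"
  obtains x :: "'a \<Rightarrow> 'a \<Rightarrow> real" where "\<And>i j. i \<in> I \<Longrightarrow> j \<in> I \<Longrightarrow> Y i j = (\<Sum>l\<in>I. x l i * x l j)"
proof (cases "I = {}")
  case True
  then show ?thesis using that by simp
next
  case False
  then obtain z where z: "z \<in> I" by blast
  obtain v c where v: "(\<Sum>i\<in>I. (v i)\<^sup>2) = 1" "\<And>i. i \<in> I \<Longrightarrow> (\<Sum>j\<in>I. Y i j * v j) = c * v i"
    using symmetric_has_eigenvector[OF fin False, of Y] sym by blast
  obtain q e where q: "orth_on I q" and Y: "\<And>i j. i \<in> I \<Longrightarrow> j \<in> I \<Longrightarrow> Y i j = (\<Sum>l\<in>I. e l * (q i l * q j l))"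
    using spectral_theorem_with_eigenvector[OF fin z, of Y v c] sym v by blast
  have "0 \<le> e l" if "l \<in> I" for l
    using psd[of "\<lambda>i. q i l"] eigenvalue_as_quadratic_form[OF fin q that, of Y e] Y by simp
  then have root: "(sqrt (e l) * q i l) * (sqrt (e l) * q j l) = e l * (q i l * q j l)"
    if "l \<in> I" for i j l
    using that by simp
  show ?thesis
  proof (rule that[of "\<lambda>l i. sqrt (e l) * q i l"])
    show "Y i j = (\<Sum>l\<in>I. (sqrt (e l) * q i l) * (sqrt (e l) * q j l))" if "i \<in> I" "j \<in> I" for i j
      unfolding Y[OF that] by (intro sum.cong refl root[symmetric])
  qed
qed

lemma weighted_sum_squares_shift:
  fixes D f :: "'a \<Rightarrow> real"
  shows "(\<Sum>i\<in>C. D i * (f i - m)\<^sup>2) = (\<Sum>i\<in>C. D i * (f i)\<^sup>2) - 2 * m * (\<Sum>i\<in>C. D i * f i) + m\<^sup>2 * (\<Sum>i\<in>C. D i)"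
  by (simp add: power2_eq_square algebra_simps sum.distrib sum_subtractf sum_distrib_left)

text \<open>After expansion in \<open>m\<close>, the two sides differ by
  \<open>V * (F / V - m)\<^sup>2\<close>, with \<open>V\<close> the total weight and
  \<open>F\<close> the weighted sum.\<close>

lemma weighted_mean_minimises:
  fixes D f :: "'a \<Rightarrow> real"
  assumes "0 < sum D C"
  shows "(\<Sum>i\<in>C. D i * (f i - (\<Sum>i\<in>C. D i * f i) / sum D C)\<^sup>2) \<le> (\<Sum>i\<in>C. D i * (f i - m)\<^sup>2)"
proof -
  define V F where "V = sum D C" and "F = (\<Sum>i\<in>C. D i * f i)"
  have V: "V > 0" using assms by (simp add: V_def)
  have "2 * m * F - m\<^sup>2 * V \<le> 2 * (F / V) * F - (F / V)\<^sup>2 * V"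
  proof -
    have "0 \<le> V * (F / V - m)\<^sup>2" using V by simp
    also have "\<dots> = (2 * (F / V) * F - (F / V)\<^sup>2 * V) - (2 * m * F - m\<^sup>2 * V)"
      using V by (simp add: power2_eq_square field_simps)
    finally show ?thesis by simp
  qed
  then show ?thesis unfolding weighted_sum_squares_shift by (simp add: V_def F_def)
qed

text \<open>The subtracted term will turn out to be the squared coefficient along the null vector of
  a cluster.\<close>

lemma weighted_variance_eq:
  fixes D f :: "'a \<Rightarrow> real"
  assumes "0 < sum D C"
  shows "(\<Sum>i\<in>C. D i * (f i - (\<Sum>i\<in>C. D i * f i) / sum D C)\<^sup>2)
    = (\<Sum>i\<in>C. D i * (f i)\<^sup>2) - (\<Sum>i\<in>C. D i * f i)\<^sup>2 / sum D C"
  unfolding weighted_sum_squares_shift using assms by (simp add: power2_eq_square)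

section \<open>Spectrum of the within-cluster Laplacian and the inequality from its gap\<close>

context clustered_graph
begin

text \<open>The symmetric normalised Laplacian of the graph without the edges between clusters. It
  is similar to the random-walk version and open to the spectral theorem.\<close>

definition lap :: "'a \<Rightarrow> 'a \<Rightarrow> real" where
  "lap i j = of_bool (i = j) - w_in i j / (sqrt (deg_in i) * sqrt (deg_in j))"

definition vol_in :: "'b \<Rightarrow> real" where "vol_in a = (\<Sum>i\<in>cluster a. deg_in i)"

lemma vol_in_pos: "i \<in> V \<Longrightarrow> 0 < vol_in (c i)"
  unfolding vol_in_def by (rule sum_pos) (auto simp: in_cluster deg_in_gt_0)

lemma sum_w_in: "i \<in> V \<Longrightarrow> (\<Sum>j\<in>cluster (c i). w_in i j) = deg_in i"
  unfolding deg_in_eq by (intro sum.cong refl) (simp add: in_cluster w_in_def)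

text \<open>Scaling by the square roots of \<open>deg_in\<close> removes the normalisation.\<close>

lemma lap_form:
  assumes "a \<in> c ` V" and F: "\<And>i. i \<in> cluster a \<Longrightarrow> F i = sqrt (deg_in i) * f i"
  shows "(\<Sum>i\<in>cluster a. F i * (\<Sum>j\<in>cluster a. lap i j * F j)) = dirichlet (cluster a) w_in f f"
  unfolding dirichlet_def
proof (rule sum.cong[OF refl])
  fix i assume i: "i \<in> cluster a"
  then have i': "i \<in> V" "c i = a" by (auto simp: in_cluster)
  note pos = deg_in_gt_0[OF i'(1)]
  have entry: "F i * (lap i j * F j) = of_bool (i = j) * (F i * F j) - w_in i j * (f i * f j)"
    if "j \<in> cluster a" for j
  proof -
    have "0 < deg_in j" using that by (auto simp: in_cluster deg_in_gt_0)
    then show ?thesis using F[OF i] F[OF that] pos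
      by (simp add: lap_def left_diff_distrib right_diff_distrib)
  qed
  have "F i * (\<Sum>j\<in>cluster a. lap i j * F j)
      = (\<Sum>j\<in>cluster a. of_bool (i = j) * (F i * F j) - w_in i j * (f i * f j))"
    unfolding sum_distrib_left by (intro sum.cong refl entry)
  also have "\<dots> = F i * F i - (\<Sum>j\<in>cluster a. w_in i j * (f i * f j))"
    unfolding sum_subtractf using i by simp
  also have "F i * F i = deg_in i * (f i * f i)"
    using pos by (simp add: F[OF i] mult_ac)
  also have "\<dots> = (\<Sum>j\<in>cluster a. w_in i j * (f i * f i))"
    using sum_w_in[OF i'(1)] i' by (simp flip: sum_distrib_right)
  finally show "F i * (\<Sum>j\<in>cluster a. lap i j * F j) = (\<Sum>j\<in>cluster a. w_in i j * (f i * f i - f i * f j))"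
    by (simp add: sum_subtractf right_diff_distrib)
qed

lemma dirichlet_in_by_cluster: "dirichlet V w_in f f = (\<Sum>a\<in>c ` V. dirichlet (cluster a) w_in f f)"
proof -
  have "(\<Sum>j\<in>V. w_in i j * (f i * f i - f i * f j)) = (\<Sum>j\<in>cluster (c i). w_in i j * (f i * f i - f i * f j))" for i
    unfolding sum_cluster by (intro sum.cong refl) (simp add: w_in_def)
  then show ?thesis unfolding dirichlet_def sum_by_cluster
    by (simp add: in_cluster)
qed

text \<open>The square roots of \<open>deg_in\<close>, normalised by \<open>vol_in\<close>, form a
  unit null vector on the cluster, and the spectral theorem is started from it at index
  \<open>z\<close>. The eigenvalues are nonnegative because each is the value of a Dirichlet
  form.\<close>

lemma cluster_spectrum:
  assumes z: "z \<in> V"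
  shows "\<exists>q e. orth_on (cluster (c z)) q \<and> e z = 0
    \<and> (\<forall>i\<in>cluster (c z). q i z = sqrt (deg_in i) / sqrt (vol_in (c z)))
    \<and> (\<forall>i\<in>cluster (c z). \<forall>j\<in>cluster (c z). lap i j = (\<Sum>l\<in>cluster (c z). e l * (q i l * q j l)))
    \<and> (\<forall>l\<in>cluster (c z). 0 \<le> e l)"
proof -
  let ?C = "cluster (c z)"
  define v where "v i = sqrt (deg_in i) / sqrt (vol_in (c z))" for i
  note vp = vol_in_pos[OF z]
  have CV: "i \<in> V" "c i = c z" if "i \<in> ?C" for i using that by (auto simp: in_cluster)
  have sym: "lap i j = lap j i" if "i \<in> ?C" "j \<in> ?C" for i j
    using w_in_out_sym(1)[OF CV(1)[OF that(1)] CV(1)[OF that(2)]] by (auto simp: lap_def mult.commute)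
  have "(\<Sum>i\<in>?C. (v i)\<^sup>2) = (\<Sum>i\<in>?C. deg_in i / vol_in (c z))"
  proof (rule sum.cong[OF refl])
    fix i assume "i \<in> ?C"
    then show "(v i)\<^sup>2 = deg_in i / vol_in (c z)"
      using vp deg_in_gt_0[OF CV(1)[of i]] by (simp add: v_def power_divide)
  qed
  also have "\<dots> = 1" using vp by (simp add: vol_in_def flip: sum_divide_distrib)
  finally have unit: "(\<Sum>i\<in>?C. (v i)\<^sup>2) = 1" .
  \<comment> \<open>The weights in row \<open>i\<close> add up to \<open>deg_in i\<close>, which
    cancels the identity part.\<close>
  have eig: "(\<Sum>j\<in>?C. lap i j * v j) = 0 * v i" if i: "i \<in> ?C" for i
  proof -
    note pos = deg_in_gt_0[OF CV(1)[OF i]]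
    have "lap i j * v j = of_bool (i = j) * v j - w_in i j / (sqrt (deg_in i) * sqrt (vol_in (c z)))"
      if "j \<in> ?C" for j
      using deg_in_gt_0[OF CV(1)[OF that]] by (simp add: lap_def v_def left_diff_distrib diff_divide_distrib)
    then have "(\<Sum>j\<in>?C. lap i j * v j)
        = (\<Sum>j\<in>?C. of_bool (i = j) * v j) - (\<Sum>j\<in>?C. w_in i j) / (sqrt (deg_in i) * sqrt (vol_in (c z)))"
      by (simp add: sum_subtractf sum_divide_distrib)
    also have "(\<Sum>j\<in>?C. w_in i j) = sqrt (deg_in i) * sqrt (deg_in i)"
      using sum_w_in[OF CV(1)[OF i]] CV(2)[OF i] pos by simp
    also have "(\<Sum>j\<in>?C. of_bool (i = j) * v j) = v i" using i by simp
    also have "sqrt (deg_in i) * sqrt (deg_in i) / (sqrt (deg_in i) * sqrt (vol_in (c z))) = v i"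
      unfolding v_def using pos by (intro nonzero_mult_divide_mult_cancel_left) simp
    finally show ?thesis by simp
  qed
  obtain q e where q: "orth_on ?C q" "e z = 0" "\<And>i. i \<in> ?C \<Longrightarrow> q i z = v i"
    and S: "\<And>i j. i \<in> ?C \<Longrightarrow> j \<in> ?C \<Longrightarrow> lap i j = (\<Sum>l\<in>?C. e l * (q i l * q j l))"
    using spectral_theorem_with_eigenvector[of ?C z lap v 0] sym unit eig z by auto
  have "0 \<le> e l" if "l \<in> ?C" for l
  proof -
    define f where "f i = q i l / sqrt (deg_in i)" for i
    have "e l = (\<Sum>i\<in>?C. q i l * (\<Sum>j\<in>?C. lap i j * q j l))"
      by (rule eigenvalue_as_quadratic_form[OF _ q(1) that S]) simp_all
    also have "\<dots> = dirichlet ?C w_in f f"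
    proof (rule lap_form)
      show "c z \<in> c ` V" using z by simp
      fix i assume "i \<in> ?C"
      then show "q i l = sqrt (deg_in i) * f i" using deg_in_gt_0[OF CV(1)[of i]] by (simp add: f_def)
    qed
    also have "\<dots> \<ge> 0"
      by (rule dirichlet_nonneg) (use w_in_out_sym(1) w_in_out_nonneg(1) in \<open>auto simp: in_cluster\<close>)
    finally show ?thesis .
  qed
  with q S show ?thesis unfolding v_def by blast
qed

text \<open>\<open>K\<close> holds one representative per cluster, and its index carries the null
  vector. Disjointness of the clusters lets all bases be stored in one pair \<open>q\<close>,
  \<open>e\<close>; only entries of \<open>q\<close> with both indices in the same cluster are
  meaningful.\<close>

lemma glued_spectrum:
  obtains q e K where "K \<subseteq> V" "inj_on c K" "c ` K = c ` V" "\<And>l. l \<in> K \<Longrightarrow> e l = (0 :: real)"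
    "\<And>l. l \<in> V \<Longrightarrow> 0 \<le> e l" "\<And>a. a \<in> c ` V \<Longrightarrow> orth_on (cluster a) q"
    "\<And>a i j. i \<in> cluster a \<Longrightarrow> j \<in> cluster a \<Longrightarrow> lap i j = (\<Sum>l\<in>cluster a. e l * (q i l * q j l))"
    "\<And>z i. z \<in> K \<Longrightarrow> i \<in> cluster (c z) \<Longrightarrow> q i z = sqrt (deg_in i) / sqrt (vol_in (c z))"
proof -
  define z where "z a = (SOME i. i \<in> V \<and> c i = a)" for a
  have z: "z a \<in> V" "c (z a) = a" if "a \<in> c ` V" for a
    using someI_ex[of "\<lambda>i. i \<in> V \<and> c i = a"] that unfolding z_def by auto
  have "\<forall>a\<in>c ` V. \<exists>p. orth_on (cluster a) (fst p) \<and> snd p (z a) = 0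
    \<and> (\<forall>i\<in>cluster a. fst p i (z a) = sqrt (deg_in i) / sqrt (vol_in a))
    \<and> (\<forall>i\<in>cluster a. \<forall>j\<in>cluster a. lap i j = (\<Sum>l\<in>cluster a. snd p l * (fst p i l * fst p j l)))
    \<and> (\<forall>l\<in>cluster a. 0 \<le> snd p l)" (is "\<forall>a\<in>_. \<exists>p. ?P a p")
  proof
    fix a assume "a \<in> c ` V"
    then show "\<exists>p. ?P a p" using cluster_spectrum[OF z(1)[of a]] z(2)[of a] by auto
  qed
  from bchoice[OF this] obtain p where p: "\<And>a. a \<in> c ` V \<Longrightarrow> ?P a (p a)" by blast
  define q where "q i = fst (p (c i)) i" for i
  define e where "e l = snd (p (c l)) l" for l
  have qe: "q i l = fst (p a) i l" "e i = snd (p a) i" if "i \<in> cluster a" for i l a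
    using that by (simp_all add: q_def e_def in_cluster)
  have ca: "a \<in> c ` V" if "i \<in> cluster a" for i a using that by (auto simp: in_cluster)
  show ?thesis
  proof (rule that[of "z ` c ` V" e q])
    show "z ` c ` V \<subseteq> V" using z by auto
    show "inj_on c (z ` c ` V)" using z by (auto intro!: inj_onI)
    show "c ` z ` c ` V = c ` V" using z by (auto simp: image_iff)
    show "e l = 0" if l: "l \<in> z ` c ` V" for l
    proof -
      obtain a where a: "a \<in> c ` V" "l = z a" using l by blast
      then show ?thesis using p[OF a(1)] z[OF a(1)] by (simp add: e_def)
    qed
    show "0 \<le> e l" if "l \<in> V" for l
      using p[of "c l"] that by (simp add: e_def)
    show "orth_on (cluster a) q" if "a \<in> c ` V" for a
      using p[OF that] unfolding orth_on_def by (simp add: qe)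
    show "lap i j = (\<Sum>l\<in>cluster a. e l * (q i l * q j l))" if "i \<in> cluster a" "j \<in> cluster a" for a i j
      using p[OF ca[OF that(1)]] that by (simp add: qe)
    show "q i y = sqrt (deg_in i) / sqrt (vol_in (c y))" if y: "y \<in> z ` c ` V" and i: "i \<in> cluster (c y)" for y i
    proof -
      obtain a where a: "a \<in> c ` V" "y = z a" using y by blast
      then show ?thesis using p[OF a(1)] z[OF a(1)] i by (simp add: qe)
    qed
  qed
qed

text \<open>On a cluster, Parseval without the null direction gives the variance with weight
  \<open>deg_in\<close>, and all other eigenvalues are at least \<open>\<mu>\<close>. The factor
  \<open>1 - \<epsilon>\<close> pays for the change of weight, as
  \<open>(1 - \<epsilon>) * deg i \<le> deg_in i\<close>.\<close>

lemma poincare: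
  assumes q: "\<And>a. a \<in> c ` V \<Longrightarrow> orth_on (cluster a) q"
    and S: "\<And>a i j. i \<in> cluster a \<Longrightarrow> j \<in> cluster a \<Longrightarrow> lap i j = (\<Sum>l\<in>cluster a. e l * (q i l * q j l))"
    and K: "K \<subseteq> V" "inj_on c K" "c ` K = c ` V"
    and qK: "\<And>z i. z \<in> K \<Longrightarrow> i \<in> cluster (c z) \<Longrightarrow> q i z = sqrt (deg_in i) / sqrt (vol_in (c z))"
    and eK: "\<And>l. l \<in> K \<Longrightarrow> e l = 0" and gap: "\<And>l. l \<in> V - K \<Longrightarrow> \<mu> \<le> e l" and "0 \<le> \<mu>"
    and eps: "\<And>i. i \<in> V \<Longrightarrow> deg_out i \<le> \<epsilon> * deg i" and "\<epsilon> \<le> 1"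
  shows "(1 - \<epsilon>) * \<mu> * variance f \<le> dirichlet V w_in f f"
proof -
  have "(1 - \<epsilon>) * \<mu> * (\<Sum>i\<in>cluster a. deg i * (f i - mean f a)\<^sup>2) \<le> dirichlet (cluster a) w_in f f"
    if a: "a \<in> c ` V" for a
  proof -
    let ?C = "cluster a"
    obtain z where z: "z \<in> K" "c z = a" using K(3) a by (metis imageE)
    then have zV: "z \<in> V" "z \<in> ?C" using K(1) by (auto simp: in_cluster)
    have CV: "i \<in> V" if "i \<in> ?C" for i using that by (auto simp: in_cluster)
    \<comment> \<open>Injectivity of \<open>c\<close> on \<open>K\<close> makes \<open>z\<close> the
      only representative in this cluster.\<close>
    have outside: "l \<in> V - K" if "l \<in> ?C - {z}" for l
      using that z K(2) by (auto simp: in_cluster inj_on_def)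
    have vi: "0 < vol_in a" using vol_in_pos[OF zV(1)] z by simp
    have vp: "0 < sum deg ?C" using vol_pos[OF zV(1)] z by (simp add: vol_def)
    define F where "F i = sqrt (deg_in i) * f i" for i
    define m where "m = (\<Sum>i\<in>?C. deg_in i * f i) / vol_in a"
    have sq: "sqrt (deg_in i) * sqrt (deg_in i) = deg_in i" if "i \<in> ?C" for i
      using deg_in_gt_0[OF CV[OF that]] by simp
    have "(\<Sum>i\<in>?C. q i z * F i) = (\<Sum>i\<in>?C. deg_in i * f i) / sqrt (vol_in a)"
      unfolding sum_divide_distrib
      by (intro sum.cong refl) (use z qK[of z] sq in \<open>simp add: F_def mult.assoc[symmetric]\<close>)
    then have qz: "(\<Sum>i\<in>?C. q i z * F i)\<^sup>2 = (\<Sum>i\<in>?C. deg_in i * f i)\<^sup>2 / vol_in a"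
      using vi by (simp add: power_divide)
    have FF: "(\<Sum>i\<in>?C. (F i)\<^sup>2) = (\<Sum>i\<in>?C. deg_in i * (f i)\<^sup>2)"
      by (intro sum.cong refl) (use deg_in_gt_0[OF CV] in \<open>simp add: F_def power_mult_distrib less_imp_le\<close>)
    \<comment> \<open>The centre is changed first: \<open>mean f a\<close> is optimal for the weight
      \<open>deg\<close>, so moving to the mean \<open>m\<close> for \<open>deg_in\<close> only
      increases the sum. The weight is changed afterwards.\<close>
    have "(1 - \<epsilon>) * (\<Sum>i\<in>?C. deg i * (f i - mean f a)\<^sup>2) \<le> (\<Sum>i\<in>?C. deg_in i * (f i - m)\<^sup>2)"
    proof -
      have "(\<Sum>i\<in>?C. deg i * (f i - mean f a)\<^sup>2) \<le> (\<Sum>i\<in>?C. deg i * (f i - m)\<^sup>2)"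
        using weighted_mean_minimises[OF vp] by (simp add: mean_def vol_def)
      then have "(1 - \<epsilon>) * (\<Sum>i\<in>?C. deg i * (f i - mean f a)\<^sup>2)
          \<le> (1 - \<epsilon>) * (\<Sum>i\<in>?C. deg i * (f i - m)\<^sup>2)"
        using \<open>\<epsilon> \<le> 1\<close> by (intro mult_left_mono) simp_all
      also have "\<dots> = (\<Sum>i\<in>?C. (1 - \<epsilon>) * deg i * (f i - m)\<^sup>2)" by (simp add: sum_distrib_left mult.assoc)
      also have "\<dots> \<le> (\<Sum>i\<in>?C. deg_in i * (f i - m)\<^sup>2)"
      proof (intro sum_mono mult_right_mono)
        fix i assume "i \<in> ?C"
        then show "(1 - \<epsilon>) * deg i \<le> deg_in i"
          using eps[OF CV[of i]] deg_split[of i] unfolding left_diff_distrib by linarith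
      qed simp
      finally show ?thesis .
    qed
    then have "\<mu> * ((1 - \<epsilon>) * (\<Sum>i\<in>?C. deg i * (f i - mean f a)\<^sup>2)) \<le> \<mu> * (\<Sum>i\<in>?C. deg_in i * (f i - m)\<^sup>2)"
      using \<open>0 \<le> \<mu>\<close> by (rule mult_left_mono)
    then have "(1 - \<epsilon>) * \<mu> * (\<Sum>i\<in>?C. deg i * (f i - mean f a)\<^sup>2) \<le> \<mu> * (\<Sum>i\<in>?C. deg_in i * (f i - m)\<^sup>2)"
      by (simp only: mult.assoc mult.left_commute[of \<mu>])
    also have "(\<Sum>i\<in>?C. deg_in i * (f i - m)\<^sup>2) = (\<Sum>i\<in>?C. (F i)\<^sup>2) - (\<Sum>i\<in>?C. q i z * F i)\<^sup>2"
      unfolding FF qz m_def vol_in_def using vi by (intro weighted_variance_eq) (simp add: vol_in_def)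
    also have "(\<Sum>i\<in>?C. (F i)\<^sup>2) = (\<Sum>l\<in>?C. (\<Sum>i\<in>?C. q i l * F i)\<^sup>2)"
      by (rule parseval[symmetric]) (simp_all add: q[OF a])
    also have "\<dots> - (\<Sum>i\<in>?C. q i z * F i)\<^sup>2 = (\<Sum>l\<in>?C - {z}. (\<Sum>i\<in>?C. q i l * F i)\<^sup>2)"
      using sum.remove[OF _ zV(2), of "\<lambda>l. (\<Sum>i\<in>?C. q i l * F i)\<^sup>2"] by simp
    also have "\<mu> * \<dots> \<le> (\<Sum>l\<in>?C - {z}. e l * (\<Sum>i\<in>?C. q i l * F i)\<^sup>2)"
      unfolding sum_distrib_left by (intro sum_mono mult_right_mono gap outside) simp_all
    also have "\<dots> = (\<Sum>l\<in>?C. e l * (\<Sum>i\<in>?C. q i l * F i)\<^sup>2)"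
      using sum.remove[OF _ zV(2), of "\<lambda>l. e l * (\<Sum>i\<in>?C. q i l * F i)\<^sup>2"] eK[OF z(1)] by simp
    also have "\<dots> = (\<Sum>i\<in>?C. F i * (\<Sum>j\<in>?C. lap i j * F j))"
      by (rule quadratic_form_diagonalised[symmetric]) (rule S)
    also have "\<dots> = dirichlet ?C w_in f f"
      by (rule lap_form[OF a]) (simp add: F_def)
    finally show ?thesis .
  qed
  then have "(\<Sum>a\<in>c ` V. (1 - \<epsilon>) * \<mu> * (\<Sum>i\<in>cluster a. deg i * (f i - mean f a)\<^sup>2))
      \<le> (\<Sum>a\<in>c ` V. dirichlet (cluster a) w_in f f)" by (rule sum_mono)
  moreover have "variance f = (\<Sum>a\<in>c ` V. \<Sum>i\<in>cluster a. deg i * (f i - mean f a)\<^sup>2)"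
    unfolding variance_def sum_by_cluster by (intro sum.cong refl) (simp add: in_cluster)
  ultimately show ?thesis unfolding dirichlet_in_by_cluster by (simp add: sum_distrib_left)
qed

end

section \<open>Lower bound for the objective at a feasible point\<close>

context sdp_point
begin

text \<open>Here \<open>\<mu>\<close> is the constant of the inequality with weight
  \<open>deg\<close>, that is, the spectral gap already multiplied by \<open>1 - \<epsilon>\<close>.
  The first sum is the objective at the cut point.\<close>

lemma energy_ge:
  assumes "\<And>f. \<mu> * variance f \<le> dirichlet V w_in f f"
    and eps: "\<And>i. i \<in> V \<Longrightarrow> deg_out i \<le> \<epsilon> * deg i"
  shows "(\<Sum>i\<in>V. deg_out i / vol (c i)) + (\<mu> - 4 * \<epsilon>) * total_leak
    \<le> (\<Sum>i\<in>V. \<Sum>j\<in>V. w i j * (Y i i - Y i j))"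
proof -
  have split: "w i j * t = w_in i j * t + w_out i j * t" for i j t
    by (simp add: w_in_def w_out_def)
  have "(\<Sum>i\<in>V. \<Sum>j\<in>V. w i j * (Y i i - Y i j))
      = (\<Sum>i\<in>V. \<Sum>j\<in>V. w_in i j * (Y i i - Y i j)) + (\<Sum>i\<in>V. \<Sum>j\<in>V. w_out i j * (Y i i - Y i j))"
    unfolding sum.distrib[symmetric] by (intro sum.cong refl split)
  then show ?thesis using energy_in_ge[OF assms(1)] energy_out_ge[OF eps]
    by (simp add: left_diff_distrib)
qed

end

section \<open>Eigenvalues of the random-walk Laplacian, globally and on clusters\<close>

context clustered_graph
begin

definition lap_rw :: "'a \<Rightarrow> 'a \<Rightarrow> real" where
  "lap_rw i j = of_bool (i = j) - w_in i j / deg_in i"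

context
  fixes q :: "'a \<Rightarrow> 'a \<Rightarrow> real" and e :: "'a \<Rightarrow> real"
  assumes q: "\<And>a. a \<in> c ` V \<Longrightarrow> orth_on (cluster a) q"
    and lap: "\<And>a i j. i \<in> cluster a \<Longrightarrow> j \<in> cluster a \<Longrightarrow> lap i j = (\<Sum>l\<in>cluster a. e l * (q i l * q j l))"
begin

text \<open>\<open>lap_rw\<close> is \<open>lap\<close> conjugated by the square roots of
  \<open>deg_in\<close>, so eigenvalues persist and eigenvectors are rescaled.\<close>

lemma lap_rw_diagonalised:
  assumes "i \<in> cluster a" "j \<in> cluster a"
  shows "lap_rw i j = (\<Sum>l\<in>cluster a. q i l / sqrt (deg_in i) * (e l * (q j l * sqrt (deg_in j))))"
    and "(\<Sum>l\<in>cluster a. q i l / sqrt (deg_in i) * (q j l * sqrt (deg_in j))) = of_bool (i = j)"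
proof -
  have pos: "0 < deg_in i" "0 < deg_in j" and a: "a \<in> c ` V"
    using assms by (auto simp: in_cluster deg_in_gt_0)
  have "lap_rw i j = lap i j * (sqrt (deg_in j) / sqrt (deg_in i))"
    using pos by (auto simp: lap_rw_def lap_def left_diff_distrib diff_divide_distrib)
  also have "\<dots> = (\<Sum>l\<in>cluster a. q i l / sqrt (deg_in i) * (e l * (q j l * sqrt (deg_in j))))"
    unfolding lap[OF assms] sum_distrib_right by (intro sum.cong refl) simp
  finally show "lap_rw i j = (\<Sum>l\<in>cluster a. q i l / sqrt (deg_in i) * (e l * (q j l * sqrt (deg_in j))))" .
  have "(\<Sum>l\<in>cluster a. q i l / sqrt (deg_in i) * (q j l * sqrt (deg_in j)))
      = (\<Sum>l\<in>cluster a. q i l * q j l) * (sqrt (deg_in j) / sqrt (deg_in i))"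
    unfolding sum_distrib_right by (intro sum.cong refl) simp
  also have "\<dots> = of_bool (i = j)"
    using q[OF a] assms pos by (simp add: orth_on_def)
  finally show "(\<Sum>l\<in>cluster a. q i l / sqrt (deg_in i) * (q j l * sqrt (deg_in j))) = of_bool (i = j)" .
qed

lemma char_poly_lap_rw_cluster:
  assumes "A \<in> carrier_mat n n" "bij_betw f {..<n} (cluster a)"
    and "\<And>r s. r < n \<Longrightarrow> s < n \<Longrightarrow> A $$ (r, s) = lap_rw (f r) (f s)"
  shows "char_poly A = (\<Prod>l\<in>cluster a. [:- e l, 1:])"
proof (rule char_poly_diagonalised[OF assms(1,2)])
  fix r s assume "r < n" "s < n"
  then have "f r \<in> cluster a" "f s \<in> cluster a" using assms(2) by (auto simp: bij_betw_def)
  then show "A $$ (r, s) = (\<Sum>l\<in>cluster a. q (f r) l / sqrt (deg_in (f r)) * (e l * (q (f s) l * sqrt (deg_in (f s)))))"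
    using lap_rw_diagonalised(1) assms(3) \<open>r < n\<close> \<open>s < n\<close> by simp
qed (rule lap_rw_diagonalised(2))

lemma char_poly_lap_rw:
  assumes "A \<in> carrier_mat n n" "bij_betw f {..<n} V"
    and "\<And>r s. r < n \<Longrightarrow> s < n \<Longrightarrow> A $$ (r, s) = lap_rw (f r) (f s)"
  shows "char_poly A = (\<Prod>l\<in>V. [:- e l, 1:])"
proof (rule char_poly_diagonalised[OF assms(1,2)])
  \<comment> \<open>The cluster bases are extended by zero to the whole vertex set, which makes the
    global matrix block diagonal.\<close>
  define p where "p i l = (if c l = c i then q i l / sqrt (deg_in i) else 0)" for i l
  define y where "y l j = (if c l = c j then q j l * sqrt (deg_in j) else 0)" for l j
  \<comment> \<open>The free factor \<open>g\<close> covers both uses: \<open>e\<close> for the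
    entries of the matrix, the constant 1 for the inverse relation.\<close>
  have collapse: "(\<Sum>l\<in>V. p i l * (g l * y l j))
      = (if c i = c j then (\<Sum>l\<in>cluster (c i). q i l / sqrt (deg_in i) * (g l * (q j l * sqrt (deg_in j)))) else 0)"
    for i j g
    unfolding sum_cluster by (auto simp: p_def y_def intro!: sum.cong sum.neutral)
  have entry: "lap_rw i j = (\<Sum>l\<in>V. p i l * (e l * y l j))" if "i \<in> V" "j \<in> V" for i j
    unfolding collapse using that lap_rw_diagonalised(1)[of i "c i" j]
    by (auto simp: in_cluster lap_rw_def w_in_def)
  show "A $$ (r, s) = (\<Sum>l\<in>V. p (f r) l * (e l * y l (f s)))" if "r < n" "s < n" for r s
  proof -
    have "f r \<in> V" "f s \<in> V" using assms(2) that by (auto simp: bij_betw_def)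
    then show ?thesis using assms(3) that entry by simp
  qed
  show "(\<Sum>l\<in>V. p i l * y l j) = of_bool (i = j)" if "i \<in> V" "j \<in> V" for i j
    using collapse[of i "\<lambda>_. 1" j] that lap_rw_diagonalised(2)[of i "c i" j]
    by (auto simp: in_cluster)
qed

end

text \<open>The sets \<open>cluster a - K\<close> make up \<open>V - K\<close>. A cluster contained
  in \<open>K\<close> contributes infinity, and \<open>K \<noteq> V\<close> keeps the overall
  minimum finite.\<close>

lemma Min_over_clusters:
  fixes e :: "'a \<Rightarrow> real"
  assumes "K \<subseteq> V" "K \<noteq> V"
  shows "ereal (Min (e ` (V - K)))
    = Min ((\<lambda>a. if K \<inter> cluster a = cluster a then \<infinity> else ereal (Min (e ` (cluster a - K \<inter> cluster a)))) ` c ` V)"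
proof (rule Min_eqI[symmetric])
  have fin: "finite (e ` (V - K))" by simp
  fix y assume "y \<in> (\<lambda>a. if K \<inter> cluster a = cluster a then \<infinity> else ereal (Min (e ` (cluster a - K \<inter> cluster a)))) ` c ` V"
  then obtain a where y: "y = (if K \<inter> cluster a = cluster a then \<infinity> else ereal (Min (e ` (cluster a - K \<inter> cluster a))))"
    by blast
  show "ereal (Min (e ` (V - K))) \<le> y"
  proof (cases "K \<inter> cluster a = cluster a")
    case False
    then have "cluster a - K \<inter> cluster a \<noteq> {}" by blast
    moreover have "cluster a - K \<inter> cluster a \<subseteq> V - K" by (auto simp: in_cluster)
    ultimately have "Min (e ` (V - K)) \<le> Min (e ` (cluster a - K \<inter> cluster a))"
      using fin by (intro Min_antimono image_mono) auto
    then show ?thesis using False y by simp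
  qed (simp add: y)
next
  have fin: "finite (e ` (V - K))" by simp
  have "V - K \<noteq> {}" using assms by blast
  then obtain l where l: "l \<in> V - K" "e l = Min (e ` (V - K))"
    using Min_in[OF fin] by (metis image_iff image_is_empty)
  have lc: "l \<in> cluster (c l) - K \<inter> cluster (c l)" using l by (auto simp: in_cluster)
  then have ne: "K \<inter> cluster (c l) \<noteq> cluster (c l)" by blast
  have "Min (e ` (cluster (c l) - K \<inter> cluster (c l))) = e l"
  proof (rule Min_eqI)
    fix y assume "y \<in> e ` (cluster (c l) - K \<inter> cluster (c l))"
    then have "y \<in> e ` (V - K)" by (auto simp: in_cluster)
    then show "e l \<le> y" using l(2) fin by simp
  qed (use lc in auto)
  then show "ereal (Min (e ` (V - K))) \<in> (\<lambda>a. if K \<inter> cluster a = cluster a then \<infinity> else ereal (Min (e ` (cluster a - K \<inter> cluster a)))) ` c ` V"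
    using l ne by (intro image_eqI[of _ _ "c l"]) simp_all
qed simp

end

section \<open>Translation to matrices\<close>

lemma mat_diag_cong: "n = m \<Longrightarrow> (\<And>i. i < m \<Longrightarrow> f i = g i) \<Longrightarrow> mat_diag n f = mat_diag m g"
  by (rule eq_matI) (auto simp: mat_diag_def)

lemma mat_diag_simps [simp]:
  "dim_row (mat_diag n f) = n" "dim_col (mat_diag n f) = n" "i < n \<Longrightarrow> mat_diag n f $$ (i, i) = f i"
  by (simp_all add: mat_diag_def)

lemma deg_mat_eq:
  assumes "A \<in> carrier_mat n n"
  shows "deg_mat A = mat_diag n (\<lambda>i. \<Sum>j<n. A $$ (i, j))"
proof -
  have "dim_row A = n" using assms by simp
  moreover have "(A *\<^sub>v ones n) $ i = (\<Sum>j<n. A $$ (i, j))" if "i < n" for i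
    using assms that by (simp add: ones_def scalar_prod_def lessThan_atLeast0)
  ultimately show ?thesis unfolding deg_mat_def by (intro mat_diag_cong) simp_all
qed

lemma diag_inv_mat_diag: "diag_inv (mat_diag n f) = mat_diag n (\<lambda>i. 1 / f i)"
  unfolding diag_inv_def by (intro mat_diag_cong) simp_all

lemma diag_sqrt_mat_diag: "diag_sqrt (mat_diag n f) = mat_diag n (\<lambda>i. sqrt (f i))"
  unfolding diag_sqrt_def by (intro mat_diag_cong) simp_all

lemma inner_mat_eq:
  assumes "A \<in> carrier_mat n n" "Z \<in> carrier_mat n n"
  shows "inner_mat A Z = (\<Sum>i<n. \<Sum>j<n. A $$ (i, j) * Z $$ (i, j))"
proof -
  have "inner_mat A Z = (\<Sum>j<n. \<Sum>i<n. A $$ (i, j) * Z $$ (i, j))"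
    using assms by (simp add: inner_mat_def tr_def scalar_prod_def lessThan_atLeast0)
  also have "\<dots> = (\<Sum>i<n. \<Sum>j<n. A $$ (i, j) * Z $$ (i, j))" by (rule sum.swap)
  finally show ?thesis .
qed

lemma quadratic_form_eq:
  assumes "Z \<in> carrier_mat n n" "v \<in> carrier_vec n"
  shows "v \<bullet> (Z *\<^sub>v v) = (\<Sum>i<n. v $ i * (\<Sum>j<n. Z $$ (i, j) * v $ j))"
  using assms by (simp add: scalar_prod_def lessThan_atLeast0)

text \<open>\<open>pick\<close> is strictly increasing, hence injective, and onto by cardinality. It
  is the numbering that \<open>submatrix\<close> uses.\<close>

lemma bij_betw_pick:
  assumes "finite S"
  shows "bij_betw (pick S) {..<card S} S"
proof -
  have "inj_on (pick S) {..<card S}"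
    by (rule linorder_inj_onI) (auto dest: pick_mono_le[of _ S])
  moreover have "pick S ` {..<card S} \<subseteq> S" using pick_in_set_le by auto
  ultimately show ?thesis
    using assms by (simp add: bij_betw_def card_image card_subset_eq)
qed

lemma mat_diag_mult_vec:
  fixes f :: "nat \<Rightarrow> real"
  assumes "v \<in> carrier_vec n"
  shows "mat_diag n f *\<^sub>v v = vec n (\<lambda>i. f i * v $ i)"
proof (rule eq_vecI)
  fix i assume "i < dim_vec (vec n (\<lambda>i. f i * v $ i))"
  then have i: "i < n" by simp
  have "(mat_diag n f *\<^sub>v v) $ i = (\<Sum>j\<in>{0..<n}. (if i = j then f j else 0) * v $ j)"
    using i assms by (simp add: mat_diag_def scalar_prod_def)
  also have "\<dots> = (\<Sum>j\<in>{0..<n}. if i = j then f j * v $ j else 0)"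
    by (intro sum.cong refl) simp
  finally show "(mat_diag n f *\<^sub>v v) $ i = vec n (\<lambda>i. f i * v $ i) $ i" using i by simp
qed simp

section \<open>The matrices of the program expressed through the clustered graph\<close>

locale partitioned_matrix =
  fixes N k :: nat and W :: "real mat" and \<Gamma> :: "nat \<Rightarrow> nat set"
  assumes W_carrier: "W \<in> carrier_mat N N"
    and W_transpose: "transpose_mat W = W"
    and W_nonneg: "0\<^sub>m N N \<le> W"
    and partition: "indexed_partition N k \<Gamma>"
    and in_deg_pos: "\<forall>a<k. \<forall>i\<in>\<Gamma> a. 0 < (\<Sum>j\<in>\<Gamma> a. W $$ (i, j))"
begin

definition cl :: "nat \<Rightarrow> nat" where "cl i = (THE a. a < k \<and> i \<in> \<Gamma> a)"

lemma cl_eqI: "a < k \<Longrightarrow> i \<in> \<Gamma> a \<Longrightarrow> cl i = a"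
  unfolding cl_def using partition
  by (intro the_equality) (auto simp: indexed_partition_def disjoint_family_on_def)

lemma cl_props:
  assumes "i < N" shows "cl i < k" "i \<in> \<Gamma> (cl i)"
proof -
  obtain a where "a < k" "i \<in> \<Gamma> a"
    using partition assms by (auto simp: indexed_partition_def)
  then show "cl i < k" "i \<in> \<Gamma> (cl i)" using cl_eqI by simp_all
qed

lemma Gamma_eq: "a < k \<Longrightarrow> \<Gamma> a = {j\<in>{..<N}. cl j = a}"
  using partition cl_props cl_eqI by (auto simp: indexed_partition_def)

lemma cl_image: "cl ` {..<N} = {..<k}"
proof -
  have "a \<in> cl ` {..<N}" if "a < k" for a
  proof -
    have "\<Gamma> a \<noteq> {}" using partition \<open>a < k\<close> by (simp add: indexed_partition_def)
    then obtain i where "i \<in> \<Gamma> a" by blast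
    then show ?thesis using Gamma_eq[OF that] by auto
  qed
  then show ?thesis using cl_props by auto
qed

lemma dims [simp]: "dim_row W = N" "dim_col W = N"
  using W_carrier by simp_all

sublocale clustered_graph "{..<N}" "\<lambda>i j. W $$ (i, j)" cl
proof
  show "W $$ (i, j) = W $$ (j, i)" if "i \<in> {..<N}" "j \<in> {..<N}" for i j
    using that W_transpose index_transpose_mat(1)[of j W i] by simp
  show "0 \<le> W $$ (i, j)" if "i \<in> {..<N}" "j \<in> {..<N}" for i j
    using that W_nonneg by (auto simp: less_eq_mat_def)
  show "0 < (\<Sum>j\<in>{j\<in>{..<N}. cl j = cl i}. W $$ (i, j))" if "i \<in> {..<N}" for i
  proof -
    have i: "cl i < k" "i \<in> \<Gamma> (cl i)" using cl_props that by simp_all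
    then show ?thesis using in_deg_pos unfolding Gamma_eq[OF i(1), symmetric] by blast
  qed
qed simp

lemma cluster_eq: "a < k \<Longrightarrow> cluster a = \<Gamma> a"
  by (simp add: Gamma_eq cluster_def)

lemma deg_mat_W: "deg_mat W = mat_diag N deg"
  unfolding deg_mat_eq[OF W_carrier] deg_def ..

lemma W_iso_eq: "W_iso k \<Gamma> W = Matrix.mat N N (\<lambda>(i, j). w_in i j)"
proof (rule eq_matI)
  fix i j assume "i < dim_row (Matrix.mat N N (\<lambda>(i, j). w_in i j))" "j < dim_col (Matrix.mat N N (\<lambda>(i, j). w_in i j))"
  then have ij: "i < N" "j < N" by simp_all
  have "(\<exists>a<k. i \<in> \<Gamma> a \<and> j \<in> \<Gamma> a) \<longleftrightarrow> cl i = cl j"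
    using cl_props[OF ij(1)] cl_props[OF ij(2)] cl_eqI by metis
  then show "W_iso k \<Gamma> W $$ (i, j) = Matrix.mat N N (\<lambda>(i, j). w_in i j) $$ (i, j)"
    using ij by (simp add: W_iso_def w_in_def)
qed (simp_all add: W_iso_def)

lemma deg_mat_W_iso: "deg_mat (W_iso k \<Gamma> W) = mat_diag N deg_in"
proof -
  have "deg_mat (W_iso k \<Gamma> W) = mat_diag N (\<lambda>i. \<Sum>j<N. W_iso k \<Gamma> W $$ (i, j))"
    by (rule deg_mat_eq) (simp add: W_iso_eq)
  also have "\<dots> = mat_diag N deg_in"
    by (rule mat_diag_cong) (simp_all add: W_iso_eq deg_in_def)
  finally show ?thesis .
qed

lemma P_iso_eq: "P_iso k \<Gamma> W = Matrix.mat N N (\<lambda>(i, j). w_in i j / deg_in i)"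
  unfolding P_iso_def deg_mat_W_iso diag_inv_mat_diag
  unfolding W_iso_eq by (subst mat_diag_mult_left[of _ N N]) (auto intro!: eq_matI)

lemma L_rw_iso_eq: "L_rw_iso k \<Gamma> W = Matrix.mat N N (\<lambda>(i, j). lap_rw i j)"
  unfolding L_rw_iso_def P_iso_eq by (rule eq_matI) (auto simp: lap_rw_def)

lemma P_delta_eq: "P_delta k \<Gamma> W = Matrix.mat N N (\<lambda>(i, j). w_out i j / deg i)"
proof -
  have "W - W_iso k \<Gamma> W = Matrix.mat N N (\<lambda>(i, j). w_out i j)"
    unfolding W_iso_eq by (rule eq_matI) (auto simp: w_in_def w_out_def)
  then show ?thesis
    unfolding P_delta_def deg_mat_W diag_inv_mat_diag
    by (simp only:, subst mat_diag_mult_left[of _ N N]) (auto intro!: eq_matI)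
qed

text \<open>Row \<open>i\<close> sums to \<open>deg_out i / deg i\<close>, which is below 1 because
  \<open>deg_in i\<close> is positive. Hence \<open>1 - \<epsilon>\<close> is positive later on;
  \<open>0 < N\<close> keeps the maximum from ranging over the empty set.\<close>

lemma norm_inf_P_delta:
  assumes "0 < N"
  shows "norm_inf (P_delta k \<Gamma> W) < 1"
    and "i < N \<Longrightarrow> deg_out i \<le> norm_inf (P_delta k \<Gamma> W) * deg i"
proof -
  have "(\<Sum>j<N. \<bar>w_out i j / deg i\<bar>) = deg_out i / deg i" if "i < N" for i
  proof -
    have "(\<Sum>j<N. \<bar>w_out i j / deg i\<bar>) = (\<Sum>j<N. w_out i j / deg i)"
      using that deg_pos[of i] w_in_out_nonneg(2)[of i] by (intro sum.cong refl) simp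
    then show ?thesis by (simp add: deg_out_def sum_divide_distrib)
  qed
  then have eq: "norm_inf (P_delta k \<Gamma> W) = Max ((\<lambda>i. deg_out i / deg i) ` {..<N})"
    unfolding norm_inf_def P_delta_eq by (intro arg_cong[of _ _ Max] image_cong) simp_all
  have "deg_out i / deg i < 1" if "i < N" for i
    using that deg_pos[of i] deg_in_gt_0[of i] deg_split[of i] by simp
  then show "norm_inf (P_delta k \<Gamma> W) < 1"
    unfolding eq using assms by (subst Max_less_iff) auto
  show "deg_out i \<le> norm_inf (P_delta k \<Gamma> W) * deg i" if "i < N"
  proof -
    have "deg_out i / deg i \<le> norm_inf (P_delta k \<Gamma> W)"
      unfolding eq using that by (intro Max_ge) auto
    then show ?thesis using deg_pos[of i] that by (simp add: pos_divide_le_eq)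
  qed
qed

lemma L_sym_eq:
  "L_sym W = Matrix.mat N N (\<lambda>(i, j). (of_bool (i = j) * deg i - W $$ (i, j)) / (sqrt (deg i) * sqrt (deg j)))"
proof -
  have "mat_diag N deg - W \<in> carrier_mat N N" using W_carrier by (intro minus_carrier_mat)
  then show ?thesis
    unfolding L_sym_def deg_mat_W diag_sqrt_mat_diag diag_inv_mat_diag
    by (subst mat_diag_mult_left[of _ N N], simp, subst mat_diag_mult_right[of _ N N])
       (auto intro!: eq_matI simp: mat_diag_def)
qed

text \<open>The square roots of degrees in \<open>Z\<close> cancel those in \<open>L_sym\<close>,
  which leaves the unnormalised Laplacian paired with \<open>Y\<close>.\<close>

lemma inner_L_sym:
  assumes "Z \<in> carrier_mat N N"
    and Y: "\<And>i j. i < N \<Longrightarrow> j < N \<Longrightarrow> Z $$ (i, j) = sqrt (deg i) * sqrt (deg j) * Y i j"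
  shows "inner_mat (L_sym W) Z = (\<Sum>i<N. \<Sum>j<N. W $$ (i, j) * (Y i i - Y i j))"
proof -
  have "L_sym W \<in> carrier_mat N N" by (simp add: L_sym_eq)
  then have "inner_mat (L_sym W) Z = (\<Sum>i<N. \<Sum>j<N. L_sym W $$ (i, j) * Z $$ (i, j))"
    using assms(1) by (rule inner_mat_eq)
  also have "\<dots> = (\<Sum>i<N. \<Sum>j<N. of_bool (i = j) * (deg i * Y i j) - W $$ (i, j) * Y i j)"
  proof (intro sum.cong refl)
    fix i j assume "i \<in> {..<N}" "j \<in> {..<N}"
    then have ij: "i < N" "j < N" by simp_all
    define p where "p = sqrt (deg i) * sqrt (deg j)"
    have "p \<noteq> 0" using deg_pos[of i] deg_pos[of j] ij by (simp add: p_def)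
    then have "L_sym W $$ (i, j) * Z $$ (i, j) = (of_bool (i = j) * deg i - W $$ (i, j)) * Y i j"
      using ij by (simp only: L_sym_eq Y p_def[symmetric]) (simp add: p_def[symmetric])
    then show "L_sym W $$ (i, j) * Z $$ (i, j) = of_bool (i = j) * (deg i * Y i j) - W $$ (i, j) * Y i j"
      by (simp only: left_diff_distrib mult.assoc)
  qed
  also have "\<dots> = (\<Sum>i<N. deg i * Y i i - (\<Sum>j<N. W $$ (i, j) * Y i j))"
    unfolding sum_subtractf by simp
  also have "\<dots> = (\<Sum>i<N. \<Sum>j<N. W $$ (i, j) * (Y i i - Y i j))"
    by (simp add: deg_def sum_distrib_right right_diff_distrib sum_subtractf)
  finally show ?thesis .
qed

lemma ind_vec_form: "a < k \<Longrightarrow> ind_vec N (\<Gamma> a) \<bullet> (mat_diag N deg *\<^sub>v ind_vec N (\<Gamma> a)) = vol a"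
proof -
  assume a: "a < k"
  have "mat_diag N deg *\<^sub>v ind_vec N (\<Gamma> a) = vec N (\<lambda>i. if i \<in> \<Gamma> a then deg i else 0)"
    by (subst mat_diag_mult_vec) (auto simp: ind_vec_def)
  then have "ind_vec N (\<Gamma> a) \<bullet> (mat_diag N deg *\<^sub>v ind_vec N (\<Gamma> a))
      = (\<Sum>i<N. ind_vec N (\<Gamma> a) $ i * (if i \<in> \<Gamma> a then deg i else 0))"
    by (simp add: scalar_prod_def lessThan_atLeast0)
  also have "\<dots> = (\<Sum>i<N. if cl i = a then deg i else 0)"
    by (intro sum.cong refl) (simp add: ind_vec_def Gamma_eq[OF a])
  finally show ?thesis by (simp add: vol_def sum_cluster)
qed

lemma X_ncut_eq:
  "X_ncut k \<Gamma> W = Matrix.mat N N (\<lambda>(i, j). sqrt (deg i) * sqrt (deg j) * (if cl i = cl j then 1 / vol (cl i) else 0))"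
proof (rule eq_matI)
  fix i j
  assume "i < dim_row (Matrix.mat N N (\<lambda>(i, j). sqrt (deg i) * sqrt (deg j) * (if cl i = cl j then 1 / vol (cl i) else 0)))"
    "j < dim_col (Matrix.mat N N (\<lambda>(i, j). sqrt (deg i) * sqrt (deg j) * (if cl i = cl j then 1 / vol (cl i) else 0)))"
  then have ij: "i < N" "j < N" by simp_all
  let ?S = "mat_diag N (\<lambda>i. sqrt (deg i))"
  have col: "col_mat (ind_vec N (\<Gamma> a)) \<in> carrier_mat N 1" for a
    using mat_of_cols_carrier(1)[of N "[ind_vec N (\<Gamma> a)]"] by (simp add: col_mat_def ind_vec_def)
  have entry: "(?S * col_mat (ind_vec N (\<Gamma> a)) * transpose_mat (col_mat (ind_vec N (\<Gamma> a))) * ?S) $$ (i, j)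
      = (if i \<in> \<Gamma> a \<and> j \<in> \<Gamma> a then sqrt (deg i) * sqrt (deg j) else 0)" for a
    using ij col[of a]
    by (subst mat_diag_mult_left[of _ N 1], simp, subst mat_diag_mult_right[of _ N N])
       (auto simp: scalar_prod_def col_mat_def ind_vec_def mat_of_cols_def)
  have "X_ncut k \<Gamma> W $$ (i, j)
      = (\<Sum>a<k. 1 / (ind_vec N (\<Gamma> a) \<bullet> (mat_diag N deg *\<^sub>v ind_vec N (\<Gamma> a)))
          * (?S * col_mat (ind_vec N (\<Gamma> a)) * transpose_mat (col_mat (ind_vec N (\<Gamma> a))) * ?S) $$ (i, j))"
    using ij by (simp add: X_ncut_def Let_def deg_mat_W diag_sqrt_mat_diag)
  also have "\<dots> = (\<Sum>a<k. 1 / vol a * (if i \<in> \<Gamma> a \<and> j \<in> \<Gamma> a then sqrt (deg i) * sqrt (deg j) else 0))"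
    unfolding entry by (intro sum.cong refl) (simp add: ind_vec_form)
  \<comment> \<open>Clusters are disjoint, so at most the cluster of \<open>i\<close> contributes to
    the entry.\<close>
  also have "\<dots> = (\<Sum>a<k. if a = cl i then (if cl i = cl j then sqrt (deg i) * sqrt (deg j) / vol a else 0) else 0)"
    using ij by (intro sum.cong refl) (auto simp: Gamma_eq)
  also have "\<dots> = sqrt (deg i) * sqrt (deg j) * (if cl i = cl j then 1 / vol (cl i) else 0)"
    using cl_props(1)[OF ij(1)] by (simp add: sum.delta)
  finally show "X_ncut k \<Gamma> W $$ (i, j)
      = Matrix.mat N N (\<lambda>(i, j). sqrt (deg i) * sqrt (deg j) * (if cl i = cl j then 1 / vol (cl i) else 0)) $$ (i, j)"
    using ij by simp
qed (simp_all add: X_ncut_def Let_def)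

lemma feasible_iff:
  "feasible k W Z \<longleftrightarrow> Z \<in> carrier_mat N N \<and> transpose_mat Z = Z \<and> psd N Z
    \<and> (\<forall>i<N. \<forall>j<N. 0 \<le> Z $$ (i, j)) \<and> (\<Sum>i<N. Z $$ (i, i)) = real k
    \<and> (\<forall>i<N. (\<Sum>j<N. Z $$ (i, j) * sqrt (deg j)) = sqrt (deg i))"
proof (cases "Z \<in> carrier_mat N N")
  case True
  have "mat_diag N (\<lambda>i. sqrt (deg i)) *\<^sub>v ones N = vec N (\<lambda>i. sqrt (deg i))"
    by (subst mat_diag_mult_vec) (auto simp: ones_def)
  then have u: "diag_sqrt (deg_mat W) *\<^sub>v ones N = vec N (\<lambda>i. sqrt (deg i))"
    by (simp add: deg_mat_W diag_sqrt_mat_diag)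
  have "Z *\<^sub>v vec N (\<lambda>i. sqrt (deg i)) = vec N (\<lambda>i. \<Sum>j<N. Z $$ (i, j) * sqrt (deg j))"
    using True by (intro eq_vecI) (auto simp: scalar_prod_def lessThan_atLeast0)
  then have fixed: "Z *\<^sub>v vec N (\<lambda>i. sqrt (deg i)) = vec N (\<lambda>i. sqrt (deg i))
      \<longleftrightarrow> (\<forall>i<N. (\<Sum>j<N. Z $$ (i, j) * sqrt (deg j)) = sqrt (deg i))"
    by (auto simp: vec_eq_iff)
  have "0\<^sub>m N N \<le> Z \<longleftrightarrow> (\<forall>i<N. \<forall>j<N. 0 \<le> Z $$ (i, j))"
    using True by (auto simp: less_eq_mat_def)
  then show ?thesis using True by (simp add: feasible_def Let_def u fixed tr_def)
qed (simp add: feasible_def Let_def)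

text \<open>Rescaling by square roots of degrees is a congruence and preserves semidefiniteness. It
  turns the fixed vector into weighted row sums 1 and the trace into a weighted trace.\<close>

lemma feasible_sdp_point:
  assumes "feasible k W Z" and Y_def: "Y = (\<lambda>i j. Z $$ (i, j) / (sqrt (deg i) * sqrt (deg j)))"
  obtains x where "sdp_point {..<N} (\<lambda>i j. W $$ (i, j)) cl Y x {..<N}"
proof -
  have Z: "Z \<in> carrier_mat N N" "transpose_mat Z = Z" "psd N Z" "\<And>i j. i < N \<Longrightarrow> j < N \<Longrightarrow> 0 \<le> Z $$ (i, j)"
    "(\<Sum>i<N. Z $$ (i, i)) = real k"
    "\<And>i. i < N \<Longrightarrow> (\<Sum>j<N. Z $$ (i, j) * sqrt (deg j)) = sqrt (deg i)"
    using assms(1) unfolding feasible_iff by auto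
  have sqrt_pos: "0 < sqrt (deg i)" "sqrt (deg i) * sqrt (deg i) = deg i" if "i < N" for i
    using deg_pos[of i] that by simp_all
  have sym: "Y i j = Y j i" if "i \<in> {..<N}" "j \<in> {..<N}" for i j
    using Z(1,2) index_transpose_mat(1)[of j Z i] that by (simp add: Y_def mult.commute)
  have pos: "0 \<le> (\<Sum>i\<in>{..<N}. f i * (\<Sum>j\<in>{..<N}. Y i j * f j))" for f
  proof -
    define v where "v = vec N (\<lambda>i. f i / sqrt (deg i))"
    have v: "v \<in> carrier_vec N" by (simp add: v_def)
    have "0 \<le> v \<bullet> (Z *\<^sub>v v)" using Z(3) v by (simp add: psd_def)
    also have "\<dots> = (\<Sum>i<N. f i * (\<Sum>j<N. Y i j * f j))"
      unfolding quadratic_form_eq[OF Z(1) v] sum_distrib_left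
      by (intro sum.cong refl) (simp add: v_def Y_def)
    finally show ?thesis .
  qed
  obtain x :: "nat \<Rightarrow> nat \<Rightarrow> real" where x: "\<And>i j. i \<in> {..<N} \<Longrightarrow> j \<in> {..<N} \<Longrightarrow> Y i j = (\<Sum>l\<in>{..<N}. x l i * x l j)"
    by (rule psd_imp_gram[OF _ sym pos]) auto
  have "sdp_point {..<N} (\<lambda>i j. W $$ (i, j)) cl Y x {..<N}"
  proof
    show "0 \<le> Y i j" if "i \<in> {..<N}" "j \<in> {..<N}" for i j
      using that Z(4) sqrt_pos(1)[of i] sqrt_pos(1)[of j] by (simp add: Y_def)
    show "(\<Sum>j\<in>{..<N}. deg j * Y i j) = 1" if "i \<in> {..<N}" for i
    proof -
      have i: "i < N" using that by simp
      have "(\<Sum>j<N. deg j * Y i j) = (\<Sum>j<N. Z $$ (i, j) * sqrt (deg j)) / sqrt (deg i)"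
        unfolding sum_divide_distrib
      proof (intro sum.cong refl)
        fix j assume "j \<in> {..<N}"
        then have j: "j < N" by simp
        have "deg j * Y i j = (sqrt (deg j) * sqrt (deg j)) * (Z $$ (i, j) / (sqrt (deg i) * sqrt (deg j)))"
          by (simp only: Y_def sqrt_pos(2)[OF j])
        also have "\<dots> = Z $$ (i, j) * sqrt (deg j) / sqrt (deg i)"
          using sqrt_pos(1)[OF i] sqrt_pos(1)[OF j] by (simp only: divide_simps mult_ac) simp
        finally show "deg j * Y i j = Z $$ (i, j) * sqrt (deg j) / sqrt (deg i)" .
      qed
      then show ?thesis using Z(6)[OF i] sqrt_pos(1)[OF i] by simp
    qed
    have "(\<Sum>i<N. deg i * Y i i) = (\<Sum>i<N. Z $$ (i, i))"
    proof (intro sum.cong refl)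
      fix i assume "i \<in> {..<N}"
      then have "0 < deg i" "sqrt (deg i) * sqrt (deg i) = deg i" using deg_pos sqrt_pos(2) by auto
      then show "deg i * Y i i = Z $$ (i, i)" by (simp add: Y_def)
    qed
    then show "(\<Sum>i\<in>{..<N}. deg i * Y i i) = card (cl ` {..<N})"
      by (simp add: Z(5) cl_image)
  qed (simp_all add: x)
  then show ?thesis by (rule that)
qed

lemma X_ncut_feasible: "feasible k W (X_ncut k \<Gamma> W)"
proof -
  \<comment> \<open>The cut point is the sum of the outer products of these vectors, one per
    cluster, which shows semidefiniteness.\<close>
  define y where "y a i = (if cl i = a then sqrt (deg i) / sqrt (vol a) else 0)" for a i
  have car: "X_ncut k \<Gamma> W \<in> carrier_mat N N" by (simp add: X_ncut_eq)
  have gram: "X_ncut k \<Gamma> W $$ (i, j) = (\<Sum>a<k. 1 * (y a i * y a j))" if "i \<in> {..<N}" "j \<in> {..<N}" for i j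
  proof -
    have "(\<Sum>a<k. 1 * (y a i * y a j)) = (\<Sum>a<k. if a = cl i then y a i * y a j else 0)"
      by (intro sum.cong refl) (simp add: y_def)
    then show ?thesis using that cl_props(1)[of i] vol_pos[of i] vol_pos[of j] by (auto simp: X_ncut_eq y_def)
  qed
  have "0 \<le> v \<bullet> (X_ncut k \<Gamma> W *\<^sub>v v)" if "v \<in> carrier_vec N" for v
  proof -
    have "(\<Sum>i<N. v $ i * (\<Sum>j<N. X_ncut k \<Gamma> W $$ (i, j) * v $ j))
        = (\<Sum>a<k. 1 * (\<Sum>i<N. y a i * v $ i)\<^sup>2)"
      by (rule quadratic_form_diagonalised) (rule gram)
    then show ?thesis unfolding quadratic_form_eq[OF car that] by (simp add: sum_nonneg)
  qed
  moreover have transpose: "transpose_mat (X_ncut k \<Gamma> W) = X_ncut k \<Gamma> W"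
    by (rule eq_matI) (auto simp: X_ncut_eq)
  ultimately have psd: "psd N (X_ncut k \<Gamma> W)" using car by (simp add: psd_def)
  have nonneg: "0 \<le> X_ncut k \<Gamma> W $$ (i, j)" if "i < N" "j < N" for i j
    using that vol_pos[of i] vol_pos[of j] deg_pos[of i] deg_pos[of j] by (simp add: X_ncut_eq)
  have "(\<Sum>i<N. X_ncut k \<Gamma> W $$ (i, i)) = (\<Sum>i<N. deg i / vol (cl i))"
    using deg_pos by (intro sum.cong refl) (simp add: X_ncut_eq less_imp_le)
  then have trace: "(\<Sum>i<N. X_ncut k \<Gamma> W $$ (i, i)) = real k"
    using sum_inverse_vol by (simp add: cl_image)
  have "(\<Sum>j<N. X_ncut k \<Gamma> W $$ (i, j) * sqrt (deg j)) = sqrt (deg i)" if "i < N" for i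
  proof -
    have "(\<Sum>j<N. X_ncut k \<Gamma> W $$ (i, j) * sqrt (deg j))
        = (\<Sum>j<N. if cl j = cl i then sqrt (deg i) * (deg j / vol (cl i)) else 0)"
    proof (intro sum.cong refl)
      fix j assume "j \<in> {..<N}"
      then have "j < N" "sqrt (deg j) * sqrt (deg j) = deg j" using deg_pos[of j] by simp_all
      then show "X_ncut k \<Gamma> W $$ (i, j) * sqrt (deg j)
          = (if cl j = cl i then sqrt (deg i) * (deg j / vol (cl i)) else 0)"
        using that by (auto simp: X_ncut_eq)
    qed
    also have "\<dots> = sqrt (deg i) * ((\<Sum>j\<in>cluster (cl i). deg j) / vol (cl i))"
      by (simp only: sum_cluster[symmetric] sum_distrib_left[symmetric] sum_divide_distrib[symmetric])
    also have "\<dots> = sqrt (deg i)" using vol_pos[of i] that by (simp flip: vol_def)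
    finally show ?thesis .
  qed
  with car transpose psd nonneg trace show ?thesis unfolding feasible_iff by blast
qed

text \<open>For the cut point \<open>Y i i - Y i j\<close> vanishes inside a cluster, so only the
  edges between clusters count.\<close>

lemma inner_X_ncut: "inner_mat (L_sym W) (X_ncut k \<Gamma> W) = (\<Sum>i<N. deg_out i / vol (cl i))"
proof -
  define Y where "Y i j = (if cl i = cl j then 1 / vol (cl i) else 0)" for i j
  have "inner_mat (L_sym W) (X_ncut k \<Gamma> W) = (\<Sum>i<N. \<Sum>j<N. W $$ (i, j) * (Y i i - Y i j))"
    by (rule inner_L_sym) (simp_all add: X_ncut_eq Y_def)
  also have "\<dots> = (\<Sum>i<N. \<Sum>j<N. w_out i j / vol (cl i))"
    by (intro sum.cong refl) (simp add: Y_def w_out_def)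
  finally show ?thesis by (simp add: deg_out_def sum_divide_distrib)
qed

text \<open>A feasible point exceeds the cut point by at least
  \<open>(\<mu> - 4 * \<epsilon>) * total_leak\<close>. The factor is positive, so a point that is
  no worse has no leak and is the cut point.\<close>

lemma X_ncut_unique_minimiser:
  assumes "\<And>f. \<mu> * variance f \<le> dirichlet {..<N} w_in f f"
    and eps: "\<And>i. i < N \<Longrightarrow> deg_out i \<le> \<epsilon> * deg i" and "4 * \<epsilon> < \<mu>"
  shows "is_arg_min (inner_mat (L_sym W)) (feasible k W) Z \<longleftrightarrow> Z = X_ncut k \<Gamma> W"
proof -
  let ?X = "X_ncut k \<Gamma> W"
  have better: "inner_mat (L_sym W) ?X \<le> inner_mat (L_sym W) Z"
    "inner_mat (L_sym W) Z \<le> inner_mat (L_sym W) ?X \<Longrightarrow> Z = ?X" if feas: "feasible k W Z" for Z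
  proof -
    define Y where "Y = (\<lambda>i j. Z $$ (i, j) / (sqrt (deg i) * sqrt (deg j)))"
    obtain x where "sdp_point {..<N} (\<lambda>i j. W $$ (i, j)) cl Y x {..<N}"
      by (rule feasible_sdp_point[OF feas Y_def])
    then interpret sdp_point "{..<N}" "\<lambda>i j. W $$ (i, j)" cl Y x "{..<N}" .
    have car: "Z \<in> carrier_mat N N" using feas by (simp add: feasible_iff)
    have ZY: "Z $$ (i, j) = sqrt (deg i) * sqrt (deg j) * Y i j" if "i < N" "j < N" for i j
      using deg_pos[of i] deg_pos[of j] that by (simp add: Y_def)
    have obj: "inner_mat (L_sym W) Z = (\<Sum>i<N. \<Sum>j<N. W $$ (i, j) * (Y i i - Y i j))"
      by (rule inner_L_sym[OF car ZY])
    have bound: "inner_mat (L_sym W) ?X + (\<mu> - 4 * \<epsilon>) * total_leak \<le> inner_mat (L_sym W) Z"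
      unfolding inner_X_ncut obj
      by (rule energy_ge[OF assms(1)]) (simp_all add: eps)
    have "0 \<le> (\<mu> - 4 * \<epsilon>) * total_leak"
      using assms(3) total_leak_nonneg by simp
    then show "inner_mat (L_sym W) ?X \<le> inner_mat (L_sym W) Z" using bound by linarith
    assume "inner_mat (L_sym W) Z \<le> inner_mat (L_sym W) ?X"
    then have "(\<mu> - 4 * \<epsilon>) * total_leak \<le> 0" using bound by linarith
    then have "total_leak = 0" using assms(3) total_leak_nonneg by (simp add: mult_le_0_iff)
    from no_leak_imp_ncut[OF this]
    have "Z $$ (i, j) = ?X $$ (i, j)" if "i < N" "j < N" for i j
      unfolding ZY[OF that] X_ncut_eq using that by simp
    then show "Z = ?X" using car by (intro eq_matI) (simp_all add: X_ncut_eq)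
  qed
  show ?thesis
  proof
    assume "is_arg_min (inner_mat (L_sym W)) (feasible k W) Z"
    then show "Z = ?X" using better(2)[of Z] X_ncut_feasible unfolding is_arg_min_def by force
  next
    assume "Z = ?X"
    then show "is_arg_min (inner_mat (L_sym W)) (feasible k W) Z"
      using better(1) X_ncut_feasible unfolding is_arg_min_def by force
  qed
qed

section \<open>Diagonal blocks and their second eigenvalues\<close>

lemma block_eq:
  assumes "a < k" "A \<in> carrier_mat N N"
  shows "block \<Gamma> a a A = Matrix.mat (card (\<Gamma> a)) (card (\<Gamma> a)) (\<lambda>(r, s). A $$ (pick (\<Gamma> a) r, pick (\<Gamma> a) s))"
proof -
  have "{i. i < N \<and> i \<in> \<Gamma> a} = \<Gamma> a" using Gamma_eq[OF assms(1)] by auto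
  then show ?thesis using assms(2) by (simp add: block_def submatrix_def)
qed

lemma Gamma_pick:
  assumes "a < k"
  shows "bij_betw (pick (\<Gamma> a)) {..<card (\<Gamma> a)} (\<Gamma> a)"
    and "r < card (\<Gamma> a) \<Longrightarrow> pick (\<Gamma> a) r < N"
proof -
  have "finite (\<Gamma> a)" using Gamma_eq[OF assms] by simp
  then show bij: "bij_betw (pick (\<Gamma> a)) {..<card (\<Gamma> a)} (\<Gamma> a)" by (rule bij_betw_pick)
  show "pick (\<Gamma> a) r < N" if "r < card (\<Gamma> a)"
    using that bij Gamma_eq[OF assms] by (auto simp: bij_betw_def)
qed

lemma block_L_rw_iso:
  assumes "a < k"
  shows "1\<^sub>m (card (\<Gamma> a)) - block \<Gamma> a a (P_iso k \<Gamma> W) = block \<Gamma> a a (L_rw_iso k \<Gamma> W)"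
proof -
  note pick = Gamma_pick[OF assms]
  have "pick (\<Gamma> a) r = pick (\<Gamma> a) s \<longleftrightarrow> r = s" if "r < card (\<Gamma> a)" "s < card (\<Gamma> a)" for r s
    using pick(1) that by (auto simp: bij_betw_def inj_on_def)
  moreover have "P_iso k \<Gamma> W \<in> carrier_mat N N" "L_rw_iso k \<Gamma> W \<in> carrier_mat N N"
    by (simp_all add: P_iso_eq L_rw_iso_eq)
  ultimately show ?thesis
    using pick(2) by (intro eq_matI) (auto simp: block_eq[OF assms] P_iso_eq L_rw_iso_eq lap_rw_def)
qed

text \<open>One glued eigenbasis yields everything: the spectrum of the whole matrix with known
  zeros at the representatives, the spectrum of each block with one known zero, and the inequality
  for the gap.\<close>

lemma lambda_blocks:
  assumes "k < N"
  obtains \<mu> where "lambda (k + 1) (L_rw_iso k \<Gamma> W) = ereal \<mu>"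
    "ereal \<mu> = Min ((\<lambda>a. lambda 2 (block \<Gamma> a a (L_rw_iso k \<Gamma> W))) ` {..<k})"
    "\<And>f \<epsilon>. \<epsilon> \<le> 1 \<Longrightarrow> (\<And>i. i < N \<Longrightarrow> deg_out i \<le> \<epsilon> * deg i)
      \<Longrightarrow> (1 - \<epsilon>) * \<mu> * variance f \<le> dirichlet {..<N} w_in f f"
proof -
  obtain q e K where K: "K \<subseteq> {..<N}" "inj_on cl K" "cl ` K = cl ` {..<N}" "\<And>l. l \<in> K \<Longrightarrow> e l = (0 :: real)"
    and e: "\<And>l. l \<in> {..<N} \<Longrightarrow> 0 \<le> e l"
    and q: "\<And>a. a \<in> cl ` {..<N} \<Longrightarrow> orth_on (cluster a) q"
    and lap: "\<And>a i j. i \<in> cluster a \<Longrightarrow> j \<in> cluster a \<Longrightarrow> lap i j = (\<Sum>l\<in>cluster a. e l * (q i l * q j l))"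
    and qK: "\<And>z i. z \<in> K \<Longrightarrow> i \<in> cluster (cl z) \<Longrightarrow> q i z = sqrt (deg_in i) / sqrt (vol_in (cl z))"
    by (rule glued_spectrum) blast
  define \<mu> where "\<mu> = Min (e ` ({..<N} - K))"
  \<comment> \<open>With exactly \<open>k\<close> representatives and \<open>k < N\<close>, some
    vertex lies outside \<open>K\<close>, so \<open>\<mu>\<close> is a minimum over a nonempty
    set.\<close>
  have "card K = k" using card_image[OF K(2)] K(3) cl_image by simp
  then have KV: "K \<noteq> {..<N}" using assms by auto
  have L: "L_rw_iso k \<Gamma> W \<in> carrier_mat N N" by (simp add: L_rw_iso_eq)
  have "char_poly (L_rw_iso k \<Gamma> W) = (\<Prod>l\<in>{..<N}. [:- e l, 1:])"
    by (rule char_poly_lap_rw[OF q lap L, of id]) (simp_all add: L_rw_iso_eq)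
  then have "lambda (card K + 1) (L_rw_iso k \<Gamma> W) = (if K = {..<N} then \<infinity> else ereal \<mu>)"
    unfolding \<mu>_def by (intro lambda_diagonalised[OF L]) (use K e in auto)
  then have 1: "lambda (k + 1) (L_rw_iso k \<Gamma> W) = ereal \<mu>" using KV \<open>card K = k\<close> by simp
  have "lambda 2 (block \<Gamma> a a (L_rw_iso k \<Gamma> W))
      = (if K \<inter> cluster a = cluster a then \<infinity> else ereal (Min (e ` (cluster a - K \<inter> cluster a))))"
    if a: "a < k" for a
  proof -
    let ?B = "block \<Gamma> a a (L_rw_iso k \<Gamma> W)"
    obtain z where z: "z \<in> K" "cl z = a" using K(3) cl_image a by (metis imageE lessThan_iff)
    \<comment> \<open>A block has one known zero, so its second eigenvalue is the least of the rest;
      a singleton cluster yields infinity.\<close>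
    then have "K \<inter> cluster a = {z}" using K(1,2) by (auto simp: in_cluster inj_on_def)
    then have two: "2 = card (K \<inter> cluster a) + 1" by simp
    have B: "?B \<in> carrier_mat (card (\<Gamma> a)) (card (\<Gamma> a))" by (simp add: block_eq[OF a L])
    have entry: "?B $$ (r, s) = lap_rw (pick (\<Gamma> a) r) (pick (\<Gamma> a) s)"
      if "r < card (\<Gamma> a)" "s < card (\<Gamma> a)" for r s
      unfolding block_eq[OF a L] unfolding L_rw_iso_eq using that Gamma_pick(2)[OF a] by simp
    have "char_poly ?B = (\<Prod>l\<in>cluster a. [:- e l, 1:])"
    proof (rule char_poly_lap_rw_cluster[OF q lap B])
      show "bij_betw (pick (\<Gamma> a)) {..<card (\<Gamma> a)} (cluster a)"
        using Gamma_pick(1)[OF a] by (simp add: cluster_eq[OF a])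
    qed (simp_all add: entry)
    then show ?thesis unfolding two
      by (intro lambda_diagonalised[OF B]) (use K e in \<open>auto simp: cluster_eq[OF a, symmetric] in_cluster\<close>)
  qed
  then have "(\<lambda>a. lambda 2 (block \<Gamma> a a (L_rw_iso k \<Gamma> W))) ` {..<k}
      = (\<lambda>a. if K \<inter> cluster a = cluster a then \<infinity> else ereal (Min (e ` (cluster a - K \<inter> cluster a)))) ` cl ` {..<N}"
    unfolding cl_image by (intro image_cong) auto
  then have 2: "ereal \<mu> = Min ((\<lambda>a. lambda 2 (block \<Gamma> a a (L_rw_iso k \<Gamma> W))) ` {..<k})"
    unfolding \<mu>_def using Min_over_clusters[OF K(1) KV, of e] by simp
  have gap: "\<mu> \<le> e l" if "l \<in> {..<N} - K" for l
    unfolding \<mu>_def using that by (intro Min_le) auto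
  have "{..<N} - K \<noteq> {}" using K(1) KV by blast
  then have "0 \<le> \<mu>" unfolding \<mu>_def using e by (subst Min_ge_iff) auto
  then have 3: "(1 - \<epsilon>) * \<mu> * variance f \<le> dirichlet {..<N} w_in f f"
    if "\<epsilon> \<le> 1" "\<And>i. i < N \<Longrightarrow> deg_out i \<le> \<epsilon> * deg i" for f \<epsilon>
    by (intro poincare[OF q lap K(1-3) qK K(4) gap]) (use that in auto)
  show ?thesis by (rule that[OF 1 2 3])
qed

end

theorem theorem3p2:
  fixes N k :: nat and W :: "real mat" and \<Gamma> :: "nat \<Rightarrow> nat set"
  assumes "k < N"
    and "W \<in> carrier_mat N N"
    and "transpose_mat W = W"
    and "0\<^sub>m N N \<le> W"
    and "indexed_partition N k \<Gamma>"
    and "\<forall>a<k. \<forall>i\<in>\<Gamma> a. 0 < (\<Sum>j\<in>\<Gamma> a. W $$ (i, j))"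
  shows "(ereal (norm_inf (P_delta k \<Gamma> W) / (1 - norm_inf (P_delta k \<Gamma> W)))
             < lambda (k + 1) (L_rw_iso k \<Gamma> W) / 4
           \<longrightarrow> (\<forall>Z. is_arg_min (\<lambda>Z. inner_mat (L_sym W) Z) (feasible k W) Z
                      \<longleftrightarrow> Z = X_ncut k \<Gamma> W))
       \<and> lambda (k + 1) (L_rw_iso k \<Gamma> W)
           = Min ((\<lambda>a. lambda 2 (block \<Gamma> a a (L_rw_iso k \<Gamma> W))) ` {..<k})
       \<and> lambda (k + 1) (L_rw_iso k \<Gamma> W)
           = Min ((\<lambda>a. lambda 2 (1\<^sub>m (card (\<Gamma> a)) - block \<Gamma> a a (P_iso k \<Gamma> W))) ` {..<k})"
proof -
  interpret partitioned_matrix N k W \<Gamma> by unfold_locales (use assms in auto)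
  obtain \<mu> where lam: "lambda (k + 1) (L_rw_iso k \<Gamma> W) = ereal \<mu>"
    and blocks: "ereal \<mu> = Min ((\<lambda>a. lambda 2 (block \<Gamma> a a (L_rw_iso k \<Gamma> W))) ` {..<k})"
    and gap: "\<And>f \<epsilon>. \<epsilon> \<le> 1 \<Longrightarrow> (\<And>i. i < N \<Longrightarrow> deg_out i \<le> \<epsilon> * deg i)
      \<Longrightarrow> (1 - \<epsilon>) * \<mu> * variance f \<le> dirichlet {..<N} w_in f f"
    by (rule lambda_blocks[OF assms(1)]) blast
  define \<epsilon> where "\<epsilon> = norm_inf (P_delta k \<Gamma> W)"
  have eps: "\<epsilon> < 1" "\<And>i. i < N \<Longrightarrow> deg_out i \<le> \<epsilon> * deg i"
    using norm_inf_P_delta assms(1) unfolding \<epsilon>_def by simp_all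
  have "is_arg_min (inner_mat (L_sym W)) (feasible k W) Z \<longleftrightarrow> Z = X_ncut k \<Gamma> W"
    if "ereal (\<epsilon> / (1 - \<epsilon>)) < lambda (k + 1) (L_rw_iso k \<Gamma> W) / 4" for Z
  proof (rule X_ncut_unique_minimiser)
    \<comment> \<open>Multiplied by the positive number \<open>1 - \<epsilon>\<close>, the
      assumption says that the coefficient of \<open>total_leak\<close> is positive.\<close>
    have "\<epsilon> / (1 - \<epsilon>) < \<mu> / 4" using that unfolding lam by simp
    then show "4 * \<epsilon> < (1 - \<epsilon>) * \<mu>" using eps(1) by (simp add: field_simps)
    show "(1 - \<epsilon>) * \<mu> * variance f \<le> dirichlet {..<N} w_in f f" for f
      by (rule gap) (use eps in auto)
  qed (rule eps(2))
  moreover have "(\<lambda>a. lambda 2 (1\<^sub>m (card (\<Gamma> a)) - block \<Gamma> a a (P_iso k \<Gamma> W))) ` {..<k}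
      = (\<lambda>a. lambda 2 (block \<Gamma> a a (L_rw_iso k \<Gamma> W))) ` {..<k}"
    by (intro image_cong refl) (simp add: block_L_rw_iso)
  ultimately show ?thesis using blocks unfolding lam \<epsilon>_def by simp
qed

end
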